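(* Let $\mathcal{C}$ be a class of left-r.e. reals such that (i) every member of $\mathcal{C}$ is high, and (ii) every high r.e. set is Turing equivalent to some member of $\mathcal{C}$. Then for any universal left-r.e. numbering $\alpha$, the set $\{e:\alpha_e\in\mathcal{C}\}$ is not a $\Sigma_4$ set; hence neither $\mathcal{C}$ nor the class of left-r.e. reals not in $\mathcal{C}$ has a left-r.e. numbering.
   Context: Reals are infinite binary sequences, identified with numbers in $[0,1]$ and with subsets of $\omega$. A real is left-r.e. if it is the limit of a recursive nondecreasing sequence of rationals. A set $A$ is high if $A'\ge_T\emptyset''$. A left-r.e. numbering is a map $e\mapsto\alpha_e=\sum_{x\in\operatorname{dom}\varphi_e}2^{-|x|}$ (with $|x|=\lceil\log(x+1)\rceil$) for some partial recursive $\langle e,x\rangle\mapsto\varphi_e(x)$; it is a numbering of a class if its range is exactly that class, and universal if its range is all left-r.e. reals. *)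

theory Defs
  imports "HOL-Analysis.Analysis" "HOL-Library.Nat_Bijection"
begin

text \<open>
  Kleene's schemata for unary functions, where tuples of arguments are coded by the Cantor
  pairing function \<^const>\<open>prod_encode\<close>.  \<open>Prec\<close> is primitive recursion on the second
  component of the argument, and \<open>Mu\<close> is unbounded search.
\<close>

datatype recf =
    Zero
  | Succ
  | Fst
  | Snd
  | Oracle
  | Tuple recf recf
  | Comp recf recf
  | Prec recf recf
  | Mu recf

abbreviation pair :: "nat \<Rightarrow> nat \<Rightarrow> nat" where
  "pair x y \<equiv> prod_encode (x, y)"

primrec run :: "nat set \<Rightarrow> recf \<Rightarrow> nat \<Rightarrow> nat option" where
  "run A Zero x = Some 0"
| "run A Succ x = Some (Suc x)"
| "run A Fst x = Some (fst (prod_decode x))"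
| "run A Snd x = Some (snd (prod_decode x))"
| "run A Oracle x = Some (of_bool (x \<in> A))"
| "run A (Tuple f g) x =
     Option.bind (run A f x) (\<lambda>u. Option.bind (run A g x) (\<lambda>v. Some (pair u v)))"
| "run A (Comp f g) x = Option.bind (run A g x) (run A f)"
| "run A (Prec f g) x =
     rec_nat (run A f (fst (prod_decode x)))
       (\<lambda>m r. Option.bind r (\<lambda>v. run A g (pair (fst (prod_decode x)) (pair m v))))
       (snd (prod_decode x))"
| "run A (Mu f) x =
     (if \<exists>n. run A f (pair x n) = Some 0 \<and> (\<forall>m<n. run A f (pair x m) \<noteq> None)
      then Some (LEAST n. run A f (pair x n) = Some 0)
      else None)"

definition partial_recursive_in :: "nat set \<Rightarrow> (nat \<Rightarrow> nat option) \<Rightarrow> bool" where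
  "partial_recursive_in A \<psi> \<longleftrightarrow> (\<exists>f. run A f = \<psi>)"

definition recursive_in :: "nat set \<Rightarrow> (nat \<Rightarrow> nat) \<Rightarrow> bool" where
  "recursive_in A h \<longleftrightarrow> partial_recursive_in A (\<lambda>x. Some (h x))"

abbreviation partial_recursive :: "(nat \<Rightarrow> nat option) \<Rightarrow> bool" where
  "partial_recursive \<equiv> partial_recursive_in {}"

abbreviation recursive :: "(nat \<Rightarrow> nat) \<Rightarrow> bool" where
  "recursive \<equiv> recursive_in {}"

definition re_set :: "nat set \<Rightarrow> bool" where
  "re_set A \<longleftrightarrow> (\<exists>\<psi>. partial_recursive \<psi> \<and> A = dom \<psi>)"

definition Turing_le :: "nat set \<Rightarrow> nat set \<Rightarrow> bool" where
  "Turing_le A B \<longleftrightarrow> recursive_in B (\<lambda>x. of_bool (x \<in> A))"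

definition Turing_equiv :: "nat set \<Rightarrow> nat set \<Rightarrow> bool" where
  "Turing_equiv A B \<longleftrightarrow> Turing_le A B \<and> Turing_le B A"

primrec goedel :: "recf \<Rightarrow> nat" where
  "goedel Zero = 0"
| "goedel Succ = 1"
| "goedel Fst = 2"
| "goedel Snd = 3"
| "goedel Oracle = 4"
| "goedel (Tuple f g) = 4 * pair (goedel f) (goedel g) + 5"
| "goedel (Comp f g) = 4 * pair (goedel f) (goedel g) + 6"
| "goedel (Prec f g) = 4 * pair (goedel f) (goedel g) + 7"
| "goedel (Mu f) = 4 * goedel f + 8"

lemma inj_goedel: "goedel f = goedel g \<Longrightarrow> f = g"
proof (induction f arbitrary: g)
  case Zero then show ?case by (cases g) auto
next
  case Succ then show ?case by (cases g) auto
next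
  case Fst then show ?case by (cases g) auto
next
  case Snd then show ?case by (cases g) auto
next
  case Oracle then show ?case by (cases g) auto
next
  case (Tuple f1 f2)
  then show ?case by (cases g) (simp_all; presburger)+
next
  case (Comp f1 f2)
  then show ?case by (cases g) (simp_all; presburger)+
next
  case (Prec f1 f2)
  then show ?case by (cases g) (simp_all; presburger)+
next
  case (Mu f)
  then show ?case by (cases g) (simp_all; presburger)+
qed

lemma surj_goedel: "\<exists>f. goedel f = n"
proof (induction n rule: less_induct)
  case (less n)
  show ?case
  proof (cases "n < 5")
    case True
    then have "n = 0 \<or> n = 1 \<or> n = 2 \<or> n = 3 \<or> n = 4" by auto
    then show ?thesis by (metis goedel.simps(1-5))
  next
    case False
    define q where "q = (n - 5) div 4"
    obtain a b where ab: "q = pair a b" by (metis prod_decode_inverse surj_pair)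
    have "a \<le> q" "b \<le> q" using ab le_prod_encode_1 le_prod_encode_2 by auto
    moreover have "q < n" using False by (auto simp: q_def)
    ultimately obtain f g h where "goedel f = a" "goedel g = b" "goedel h = q"
      by (meson le_less_trans less.IH)
    moreover have "n = 4 * q + 5 \<or> n = 4 * q + 6 \<or> n = 4 * q + 7 \<or> n = 4 * q + 8"
      using False unfolding q_def by presburger
    ultimately show ?thesis using ab by (metis goedel.simps(6-9))
  qed
qed

text \<open>Since \<^const>\<open>goedel\<close> is a bijection, this is \<open>{e. \<Phi>\<^sub>e\<^sup>A(e) is defined}\<close>.\<close>

definition jump :: "nat set \<Rightarrow> nat set" where
  "jump A = {goedel f | f. run A f (goedel f) \<noteq> None}"

definition high :: "nat set \<Rightarrow> bool" where
  "high A \<longleftrightarrow> Turing_le (jump (jump {})) (jump A)"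

text \<open>
  \<open>\<Sigma>\<^sub>0\<close> sets are the recursive ones, and a \<open>\<Sigma>\<^sub>n\<^sub>+\<^sub>1\<close> set is the projection
  of a \<open>\<Pi>\<^sub>n\<close> set, that is, of the complement of a \<open>\<Sigma>\<^sub>n\<close> set \<open>B\<close>.
\<close>

primrec Sigma_set :: "nat \<Rightarrow> nat set \<Rightarrow> bool" where
  "Sigma_set 0 A \<longleftrightarrow> recursive (\<lambda>x. of_bool (x \<in> A))"
| "Sigma_set (Suc n) A \<longleftrightarrow> (\<exists>B. Sigma_set n B \<and> A = {x. \<exists>y. pair x y \<in> - B})"

text \<open>
  The set identified with a real in the unit interval; \<open>n\<close> is the position of weight
  \<open>2\<^sup>-\<^sup>(\<^sup>n\<^sup>+\<^sup>1\<^sup>)\<close>.  Dyadic rationals below 1 get their terminating expansion (both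
  expansions are recursive), whereas 1 only has the expansion \<open>0.111\<dots>\<close>.
\<close>

definition set_of_real :: "real \<Rightarrow> nat set" where
  "set_of_real r = (if r = 1 then UNIV else {n. odd \<lfloor>2 ^ Suc n * r\<rfloor>})"

lemma set_of_real_sums:
  assumes "0 \<le> r" "r \<le> 1"
  shows "(\<lambda>n. if n \<in> set_of_real r then (1 / 2) ^ Suc n else 0) sums r"
proof (cases "r = 1")
  case True
  then show ?thesis using power_half_series by (simp add: set_of_real_def)
next
  case False
  have partial: "(\<Sum>i<n. if i \<in> set_of_real r then (1 / 2) ^ Suc i else 0)
      = (of_int \<lfloor>2 ^ n * r\<rfloor> / 2 ^ n :: real)" for n
  proof (induction n)
    case 0
    have "\<lfloor>r\<rfloor> = 0" using assms False by (simp add: floor_eq_iff)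
    then show ?case by simp
  next
    case (Suc n)
    have "\<lfloor>2 ^ Suc n * r\<rfloor> div 2 = \<lfloor>2 ^ Suc n * r / 2\<rfloor>"
      using floor_divide_real_eq_div[of 2 "2 ^ Suc n * r"] by simp
    then have d: "\<lfloor>2 ^ Suc n * r\<rfloor> div 2 = \<lfloor>2 ^ n * r\<rfloor>" by simp
    have "\<lfloor>2 ^ Suc n * r\<rfloor> = 2 * \<lfloor>2 ^ n * r\<rfloor> + of_bool (n \<in> set_of_real r)"
      using d div_mult_mod_eq[of "\<lfloor>2 ^ Suc n * r\<rfloor>" 2] False
      by (simp add: set_of_real_def odd_iff_mod_2_eq_one even_iff_mod_2_eq_zero)
    then show ?case using Suc by (simp add: field_simps)
  qed
  have "(\<lambda>n. of_int \<lfloor>2 ^ n * r\<rfloor> / 2 ^ n :: real) \<longlonglongrightarrow> r"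
  proof (rule real_tendsto_sandwich)
    have "r - (1 / 2) ^ n \<le> of_int \<lfloor>2 ^ n * r\<rfloor> / 2 ^ n" for n
      using divide_right_mono[OF real_of_int_floor_add_one_ge[of "2 ^ n * r"], of "2 ^ n"]
      by (simp add: add_divide_distrib power_one_over diff_le_eq)
    then show "\<forall>\<^sub>F n in sequentially. r - (1 / 2) ^ n \<le> of_int \<lfloor>2 ^ n * r\<rfloor> / 2 ^ n" by simp
    have "of_int \<lfloor>2 ^ n * r\<rfloor> / 2 ^ n \<le> r" for n
      using of_int_floor_le[of "2 ^ n * r"] by (simp add: field_simps)
    then show "\<forall>\<^sub>F n in sequentially. of_int \<lfloor>2 ^ n * r\<rfloor> / 2 ^ n \<le> r" by simp
    have "(\<lambda>n. r - (1 / 2) ^ n) \<longlonglongrightarrow> r - 0"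
      by (intro tendsto_diff tendsto_const LIMSEQ_power_zero) simp
    then show "(\<lambda>n. r - (1 / 2) ^ n) \<longlonglongrightarrow> r" by simp
  qed simp
  then show ?thesis unfolding sums_def partial .
qed

definition recursive_rat_seq :: "(nat \<Rightarrow> rat) \<Rightarrow> bool" where
  "recursive_rat_seq q \<longleftrightarrow>
     (\<exists>a b c. recursive a \<and> recursive b \<and> recursive c \<and>
        (\<forall>n. q n = (of_nat (a n) - of_nat (b n)) / of_nat (Suc (c n))))"

definition left_re_reals :: "real set" where
  "left_re_reals =
     {r \<in> {0..1}. \<exists>q. recursive_rat_seq q \<and> incseq q \<and> (\<lambda>n. real_of_rat (q n)) \<longlonglongrightarrow> r}"

definition len :: "nat \<Rightarrow> nat" where
  "len x = nat \<lceil>log 2 (real x + 1)\<rceil>"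

text \<open>
  The sum of all weights diverges, so it is part of the definition that each of the sums
  converges to a number in the unit interval.
\<close>

definition left_re_numbering :: "(nat \<Rightarrow> real) \<Rightarrow> bool" where
  "left_re_numbering \<alpha> \<longleftrightarrow>
     (\<exists>\<psi>. partial_recursive \<psi> \<and>
        (\<forall>e. \<alpha> e \<in> {0..1} \<and>
             ((\<lambda>x. (1 / 2) ^ len x) has_sum \<alpha> e) (dom (\<lambda>x. \<psi> (pair e x)))))"

definition left_re_numbering_of :: "(nat \<Rightarrow> real) \<Rightarrow> real set \<Rightarrow> bool" where
  "left_re_numbering_of \<alpha> C \<longleftrightarrow> left_re_numbering \<alpha> \<and> range \<alpha> = C"

definition universal_left_re_numbering :: "(nat \<Rightarrow> real) \<Rightarrow> bool" where
  "universal_left_re_numbering \<alpha> \<longleftrightarrow> left_re_numbering_of \<alpha> left_re_reals"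

end

theory Submission
  imports Defs
begin

text \<open>
  Let \<open>K\<close> be the halting set.  A \<open>\<Sigma>\<^sub>4\<close> index set of \<open>C\<close> would make \<open>{z. W\<^sub>z is high}\<close> a \<open>\<Sigma>\<^sub>4\<close>
  set for every uniformly r.e. sequence \<open>W\<close>: by the assumptions on \<open>C\<close>, \<open>W\<^sub>z\<close> is high iff it is
  Turing equivalent to the left cut of some member of \<open>C\<close>, and Turing reducibility between r.e.
  sets is \<open>\<Sigma>\<^sub>4\<close> in the indices.  So it suffices to find, for a \<open>\<Pi>\<^sub>4\<close> set \<open>P\<close> that is not \<open>\<Sigma>\<^sub>4\<close>, a
  uniformly r.e. sequence \<open>A\<^sub>z\<close> such that \<open>A\<^sub>z\<close> is high iff \<open>z \<in> P\<close>.

  Write \<open>z \<in> P\<close> as \<open>\<forall>m. \<exists>k. \<forall>l. h(z,m,k,l) \<in> K\<close>.  The r.e. set \<open>A = A\<^sub>z\<close> is built together with a set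
  \<open>B\<close> that is r.e. in \<open>A\<close>, by two nested finite injury constructions in the style of
  pseudojump inversion.  The outer one codes \<open>n \<in> K\<close> into \<open>A\<close> at a location beyond all stages at which
  numbers up to \<open>n\<close> entered \<open>B\<close>.  Hence an approximation to \<open>K\<close> that is read off from \<open>A\<close> can be wrong below \<open>u\<close>
  only as long as \<open>B\<close> still changes below \<open>u\<close>, and a computation from \<open>K\<close> is preserved by restraining \<open>B\<close>.
  The inner construction preserves computations from \<open>K\<close> with priority \<open>e\<close> for the computation of
  program \<open>e\<close> on input \<open>e\<close>.  On level \<open>m\<close> it codes the jump of \<open>A\<close> into \<open>B\<close>, dealing with the number \<open>x\<close> only while
  \<open>\<forall>k\<le>x. \<exists>l. h(z,m,k,l) \<notin> K\<close> looks true.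

  If \<open>z \<in> P\<close>, every level acts only finitely often, so the jump of \<open>K\<close> is a limit of functions recursive
  in \<open>A\<close> and \<open>A\<close> is high.  Otherwise the first level at which \<open>\<exists>k. \<forall>l. h(z,m,k,l) \<in> K\<close> fails codes the jump of \<open>A\<close>
  into \<open>B\<close> up to a function recursive in \<open>K\<close>; as \<open>B\<close> is recursive in \<open>K\<close>, so is the jump of \<open>A\<close>, and \<open>A\<close> is not high.
\<close>

section \<open>Closure properties of the recursive functions\<close>

abbreviation pfst :: "nat \<Rightarrow> nat" where "pfst x \<equiv> fst (prod_decode x)"
abbreviation psnd :: "nat \<Rightarrow> nat" where "psnd x \<equiv> snd (prod_decode x)"

lemma prod_decode_pfst_psnd: "pair (pfst x) (psnd x) = x"
  by simp

abbreviation decidable_in :: "nat set \<Rightarrow> (nat \<Rightarrow> bool) \<Rightarrow> bool" where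
  "decidable_in A P \<equiv> recursive_in A (\<lambda>x. of_bool (P x))"

named_theorems recI

lemma recursive_inI: "(\<And>x. run A p x = Some (f x)) \<Longrightarrow> recursive_in A f"
  unfolding recursive_in_def partial_recursive_in_def by blast

lemma recursive_inE:
  assumes "recursive_in A f"
  obtains p where "\<And>x. run A p x = Some (f x)"
  using assms unfolding recursive_in_def partial_recursive_in_def by (metis (no_types))

lemma recursive_comp:
  assumes "recursive_in A f" "recursive_in A g"
  shows "recursive_in A (\<lambda>x. f (g x))"
proof -
  obtain p q where "\<And>x. run A p x = Some (f x)" "\<And>x. run A q x = Some (g x)"
    using assms by (metis recursive_inE)
  then show ?thesis by (intro recursive_inI[of _ "Comp p q"]) simp
qed

lemma recursive_id [recI]: "recursive_in A (\<lambda>x. x)"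
  by (rule recursive_inI[of _ "Tuple Fst Snd"]) simp

lemma recursive_const [recI]: "recursive_in A (\<lambda>x. c)"
proof (induction c)
  case 0
  show ?case by (rule recursive_inI[of _ Zero]) simp
next
  case (Suc c)
  then obtain p where "\<And>x. run A p x = Some c" by (metis recursive_inE)
  then show ?case by (intro recursive_inI[of _ "Comp Succ p"]) simp
qed

lemma recursive_Suc [recI]: "recursive_in A f \<Longrightarrow> recursive_in A (\<lambda>x. Suc (f x))"
  by (rule recursive_comp[of _ Suc], rule recursive_inI[of _ Succ]) auto

lemma recursive_pfst [recI]: "recursive_in A f \<Longrightarrow> recursive_in A (\<lambda>x. pfst (f x))"
  by (rule recursive_comp[of _ pfst], rule recursive_inI[of _ Fst]) auto

lemma recursive_psnd [recI]: "recursive_in A f \<Longrightarrow> recursive_in A (\<lambda>x. psnd (f x))"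
  by (rule recursive_comp[of _ psnd], rule recursive_inI[of _ Snd]) auto

lemma recursive_oracle: "recursive_in A f \<Longrightarrow> decidable_in A (\<lambda>x. f x \<in> A)"
  by (rule recursive_comp[of _ "\<lambda>x. of_bool (x \<in> A)"], rule recursive_inI[of _ Oracle]) auto

lemma recursive_pair [recI]:
  assumes "recursive_in A f" "recursive_in A g"
  shows "recursive_in A (\<lambda>x. pair (f x) (g x))"
proof -
  obtain p q where "\<And>x. run A p x = Some (f x)" "\<And>x. run A q x = Some (g x)"
    using assms by (metis recursive_inE)
  then show ?thesis by (intro recursive_inI[of _ "Tuple p q"]) simp
qed

lemma recursive_comp2:
  assumes "recursive_in A (\<lambda>p. f (pfst p) (psnd p))" "recursive_in A g" "recursive_in A h"
  shows "recursive_in A (\<lambda>x. f (g x) (h x))"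
  using recursive_comp[OF assms(1) recursive_pair[OF assms(2,3)]] by simp

lemma recursive_comp3:
  assumes "recursive_in A (\<lambda>p. f (pfst p) (pfst (psnd p)) (psnd (psnd p)))"
    "recursive_in A g" "recursive_in A h" "recursive_in A k"
  shows "recursive_in A (\<lambda>x. f (g x) (h x) (k x))"
  using recursive_comp[OF assms(1) recursive_pair[OF assms(2) recursive_pair[OF assms(3,4)]]] by simp

lemma recursive_comp4:
  assumes "recursive_in A (\<lambda>p. f (pfst p) (pfst (psnd p)) (pfst (psnd (psnd p))) (psnd (psnd (psnd p))))"
    "recursive_in A g" "recursive_in A h" "recursive_in A k" "recursive_in A l"
  shows "recursive_in A (\<lambda>x. f (g x) (h x) (k x) (l x))"
  using recursive_comp[OF assms(1) recursive_pair[OF assms(2)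
        recursive_pair[OF assms(3) recursive_pair[OF assms(4,5)]]]] by simp

lemma recursive_comp5:
  assumes "recursive_in A (\<lambda>p. f (pfst p) (pfst (psnd p)) (pfst (psnd (psnd p)))
      (pfst (psnd (psnd (psnd p)))) (psnd (psnd (psnd (psnd p)))))"
    "recursive_in A g" "recursive_in A h" "recursive_in A k" "recursive_in A l" "recursive_in A m"
  shows "recursive_in A (\<lambda>x. f (g x) (h x) (k x) (l x) (m x))"
  using recursive_comp[OF assms(1) recursive_pair[OF assms(2)
        recursive_pair[OF assms(3) recursive_pair[OF assms(4) recursive_pair[OF assms(5,6)]]]]] by simp

lemma recursive_rec_nat [recI]:
  assumes "recursive_in A f"
    and "recursive_in A (\<lambda>p. g (pfst p) (pfst (psnd p)) (psnd (psnd p)))"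
    and "recursive_in A n"
  shows "recursive_in A (\<lambda>x. rec_nat (f x) (g x) (n x))"
proof -
  obtain p where p: "\<And>x. run A p x = Some (f x)"
    by (rule recursive_inE[OF assms(1)]) blast
  obtain q where q: "\<And>x. run A q x = Some (g (pfst x) (pfst (psnd x)) (psnd (psnd x)))"
    by (rule recursive_inE[OF assms(2)]) blast
  have "rec_nat (Some (f x)) (\<lambda>m r. Option.bind r (\<lambda>v. run A q (pair x (pair m v)))) m
      = Some (rec_nat (f x) (g x) m)" for x m
    by (induction m) (simp_all add: q)
  then have "recursive_in A (\<lambda>p. rec_nat (f (pfst p)) (g (pfst p)) (psnd p))"
    by (intro recursive_inI[of _ "Prec p q"]) (simp add: p)
  from recursive_comp2[OF this recursive_id assms(3)] show ?thesis .
qed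

lemma recursive_add [recI]:
  assumes "recursive_in A f" "recursive_in A g"
  shows "recursive_in A (\<lambda>x. f x + g x)"
proof -
  have "rec_nat a (\<lambda>m r. Suc r) b = a + b" for a b by (induction b) auto
  then have "(\<lambda>x. f x + g x) = (\<lambda>x. rec_nat (f x) (\<lambda>m r. Suc r) (g x))" by simp
  then show ?thesis using assms by (simp only:) (intro recI)
qed

lemma recursive_mult [recI]:
  assumes "recursive_in A f" "recursive_in A g"
  shows "recursive_in A (\<lambda>x. f x * g x)"
proof -
  have "rec_nat 0 (\<lambda>m r. r + a) b = a * b" for a b :: nat by (induction b) auto
  then have "(\<lambda>x. f x * g x) = (\<lambda>x. rec_nat 0 (\<lambda>m r. r + f x) (g x))" by simp
  then show ?thesis
    using assms(2) by (simp only:) (intro recI recursive_comp[OF assms(1)])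
qed

lemma recursive_pred [recI]:
  assumes "recursive_in A f"
  shows "recursive_in A (\<lambda>x. f x - 1)"
proof -
  have "rec_nat 0 (\<lambda>m r. m) b = b - 1" for b :: nat by (induction b) auto
  then have "(\<lambda>x. f x - 1) = (\<lambda>x. rec_nat 0 (\<lambda>m r. m) (f x))" by simp
  then show ?thesis using assms by (simp only:) (intro recI)
qed

lemma recursive_diff [recI]:
  assumes "recursive_in A f" "recursive_in A g"
  shows "recursive_in A (\<lambda>x. f x - g x)"
proof -
  have "rec_nat a (\<lambda>m r. r - 1) b = a - b" for a b :: nat by (induction b) auto
  then have "(\<lambda>x. f x - g x) = (\<lambda>x. rec_nat (f x) (\<lambda>m r. r - 1) (g x))" by simp
  then show ?thesis using assms by (simp only:) (intro recI)
qed

lemma recursive_power [recI]: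
  assumes "recursive_in A f" "recursive_in A g"
  shows "recursive_in A (\<lambda>x. f x ^ g x)"
proof -
  have "rec_nat 1 (\<lambda>m r. r * a) b = a ^ b" for a b :: nat by (induction b) auto
  then have "(\<lambda>x. f x ^ g x) = (\<lambda>x. rec_nat 1 (\<lambda>m r. r * f x) (g x))" by simp
  then show ?thesis
    using assms(2) by (simp only:) (intro recI recursive_comp[OF assms(1)])
qed

section \<open>Decidable predicates and bounded quantifiers\<close>

lemma decidable_not [recI]:
  assumes "decidable_in A P" shows "decidable_in A (\<lambda>x. \<not> P x)"
proof -
  have "(\<lambda>x. of_bool (\<not> P x)) = (\<lambda>x. 1 - of_bool (P x) :: nat)" by auto
  then show ?thesis using assms by (simp only:) (intro recI)
qed

lemma decidable_conj [recI]:
  assumes "decidable_in A P" "decidable_in A Q" shows "decidable_in A (\<lambda>x. P x \<and> Q x)"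
proof -
  have "(\<lambda>x. of_bool (P x \<and> Q x)) = (\<lambda>x. of_bool (P x) * of_bool (Q x) :: nat)" by auto
  then show ?thesis using assms by (simp only:) (intro recI)
qed

lemma decidable_disj [recI]:
  assumes "decidable_in A P" "decidable_in A Q" shows "decidable_in A (\<lambda>x. P x \<or> Q x)"
proof -
  have "decidable_in A (\<lambda>x. \<not> (\<not> P x \<and> \<not> Q x))" using assms by (intro recI)
  then show ?thesis by simp
qed

lemma decidable_imp [recI]:
  assumes "decidable_in A P" "decidable_in A Q" shows "decidable_in A (\<lambda>x. P x \<longrightarrow> Q x)"
proof -
  have "decidable_in A (\<lambda>x. \<not> P x \<or> Q x)" using assms by (intro recI)
  then show ?thesis by (simp only: imp_conv_disj)
qed

lemma decidable_iff [recI]: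
  assumes "decidable_in A P" "decidable_in A Q" shows "decidable_in A (\<lambda>x. P x \<longleftrightarrow> Q x)"
proof -
  have "decidable_in A (\<lambda>x. (P x \<longrightarrow> Q x) \<and> (Q x \<longrightarrow> P x))" using assms by (intro recI)
  then show ?thesis by (simp only: iff_conv_conj_imp)
qed

lemma decidable_le [recI]:
  assumes "recursive_in A f" "recursive_in A g" shows "decidable_in A (\<lambda>x. f x \<le> g x)"
proof -
  have "(\<lambda>x. of_bool (f x \<le> g x)) = (\<lambda>x. 1 - (f x - g x))" by auto
  then show ?thesis using assms by (simp only:) (intro recI)
qed

lemma decidable_less [recI]:
  assumes "recursive_in A f" "recursive_in A g" shows "decidable_in A (\<lambda>x. f x < g x)"
proof -
  have "decidable_in A (\<lambda>x. \<not> g x \<le> f x)" using assms by (intro recI)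
  then show ?thesis by (simp only: not_le)
qed

lemma decidable_eq [recI]:
  fixes f g :: "nat \<Rightarrow> nat"
  assumes "recursive_in A f" "recursive_in A g" shows "decidable_in A (\<lambda>x. f x = g x)"
proof -
  have "decidable_in A (\<lambda>x. f x \<le> g x \<and> g x \<le> f x)" using assms by (intro recI)
  then show ?thesis by (simp only: eq_iff)
qed

lemma recursive_if [recI]:
  assumes "decidable_in A P" "recursive_in A f" "recursive_in A g"
  shows "recursive_in A (\<lambda>x. if P x then f x else g x)"
proof -
  have "(\<lambda>x. if P x then f x else g x) = (\<lambda>x. of_bool (P x) * f x + (1 - of_bool (P x)) * g x)"
    by auto
  then show ?thesis using assms by (simp only:) (intro recI)
qed

lemma decidable_if [recI]:
  assumes "decidable_in A P" "decidable_in A Q" "decidable_in A R"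
  shows "decidable_in A (\<lambda>x. if P x then Q x else R x)"
proof -
  have "decidable_in A (\<lambda>x. (P x \<and> Q x) \<or> (\<not> P x \<and> R x))" using assms by (intro recI)
  then show ?thesis by (simp only: if_bool_eq_disj)
qed

lemma decidable_Ex_less [recI]:
  assumes "decidable_in A (\<lambda>p. P (pfst p) (psnd p))" "recursive_in A b"
  shows "decidable_in A (\<lambda>x. \<exists>k<b x. P x k)"
proof -
  have "rec_nat (0::nat) (\<lambda>m r. if P x m then 1 else r) n = of_bool (\<exists>k<n. P x k)" for x n
    by (induction n) (auto simp: less_Suc_eq)
  then have "(\<lambda>x. of_bool (\<exists>k<b x. P x k)) = (\<lambda>x. rec_nat (0::nat) (\<lambda>m r. if P x m then 1 else r) (b x))"
    by (simp only:)
  moreover have "decidable_in A (\<lambda>p. P (pfst p) (pfst (psnd p)))"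
    by (rule recursive_comp2[OF assms(1) recursive_pfst[OF recursive_id]
          recursive_pfst[OF recursive_psnd[OF recursive_id]]])
  ultimately show ?thesis using assms(2) by (simp only:) (intro recI)
qed

lemma decidable_All_less [recI]:
  assumes "decidable_in A (\<lambda>p. P (pfst p) (psnd p))" "recursive_in A b"
  shows "decidable_in A (\<lambda>x. \<forall>k<b x. P x k)"
proof -
  have "decidable_in A (\<lambda>x. \<not> (\<exists>k<b x. \<not> P x k))" using assms by (intro recI)
  then show ?thesis by simp
qed

lemma decidable_Ex_le [recI]:
  assumes "decidable_in A (\<lambda>p. P (pfst p) (psnd p))" "recursive_in A b"
  shows "decidable_in A (\<lambda>x. \<exists>k\<le>b x. P x k)"
proof -
  have "decidable_in A (\<lambda>x. \<exists>k<Suc (b x). P x k)" using assms by (intro recI)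
  then show ?thesis by (simp only: less_Suc_eq_le)
qed

lemma decidable_All_le [recI]:
  assumes "decidable_in A (\<lambda>p. P (pfst p) (psnd p))" "recursive_in A b"
  shows "decidable_in A (\<lambda>x. \<forall>k\<le>b x. P x k)"
proof -
  have "decidable_in A (\<lambda>x. \<forall>k<Suc (b x). P x k)" using assms by (intro recI)
  then show ?thesis by (simp only: less_Suc_eq_le)
qed

section \<open>Unbounded search, division, and finite sets coded by numbers\<close>

lemma recursive_Least [recI]:
  assumes "decidable_in A (\<lambda>p. P (pfst p) (psnd p))" "\<And>x. \<exists>n. P x n"
  shows "recursive_in A (\<lambda>x. LEAST n. P x n)"
proof -
  have "recursive_in A (\<lambda>p. 1 - of_bool (P (pfst p) (psnd p)))" using assms(1) by (intro recI)
  from recursive_inE[OF this]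
  obtain p where "\<And>x. run A p x = Some (1 - of_bool (P (pfst x) (psnd x)))" by blast
  then have "run A (Mu p) x = Some (LEAST n. P x n)" for x
    using assms(2) by (simp add: of_bool_def)
  then show ?thesis by (rule recursive_inI)
qed

lemma recursive_div [recI]:
  fixes f g :: "nat \<Rightarrow> nat"
  assumes "recursive_in A f" "recursive_in A g"
  shows "recursive_in A (\<lambda>x. f x div g x)"
proof -
  \<comment> \<open>The disjunct \<open>b = 0\<close> keeps the search total and makes it return 0,
    the value of division by 0.\<close>
  have ex: "b = 0 \<or> a < Suc (a div b) * b" for a b :: nat
    by (cases "b = 0") (auto simp: dividend_less_div_times)
  have "(LEAST q. b = 0 \<or> a < Suc q * b) = a div b" for a b :: nat
  proof (rule Least_equality)
    show "b = 0 \<or> a < Suc (a div b) * b" by (rule ex)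
    show "a div b \<le> q" if "b = 0 \<or> a < Suc q * b" for q
      using that by (metis div_by_0 le0 less_Suc_eq_le less_mult_imp_div_less)
  qed
  then have "(\<lambda>x. f x div g x) = (\<lambda>x. LEAST q. g x = 0 \<or> f x < Suc q * g x)" by simp
  moreover have "recursive_in A (\<lambda>x. LEAST q. g x = 0 \<or> f x < Suc q * g x)"
    by (intro recI recursive_comp[OF assms(1)] recursive_comp[OF assms(2)]) (use ex in blast)
  ultimately show ?thesis by simp
qed

lemma recursive_mod [recI]:
  fixes f g :: "nat \<Rightarrow> nat"
  assumes "recursive_in A f" "recursive_in A g"
  shows "recursive_in A (\<lambda>x. f x mod g x)"
proof -
  have "recursive_in A (\<lambda>x. f x - (f x div g x) * g x)" using assms by (intro recI)
  then show ?thesis by (simp only: minus_div_mult_eq_mod)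
qed

lemma decidable_odd [recI]:
  fixes f :: "nat \<Rightarrow> nat"
  assumes "recursive_in A f"
  shows "decidable_in A (\<lambda>x. odd (f x))"
proof -
  have "decidable_in A (\<lambda>x. f x mod 2 = 1)" using assms by (intro recI)
  then show ?thesis by (simp only: odd_iff_mod_2_eq_one)
qed

lemma decidable_set_decode [recI]:
  assumes "recursive_in A f" "recursive_in A g"
  shows "decidable_in A (\<lambda>x. f x \<in> set_decode (g x))"
proof -
  have "decidable_in A (\<lambda>x. odd (g x div 2 ^ f x))" using assms by (intro recI)
  then show ?thesis by (simp only: set_decode_def mem_Collect_eq)
qed

lemma recursive_set_encode [recI]:
  assumes "decidable_in A (\<lambda>p. P (pfst p) (psnd p))" "recursive_in A b"
  shows "recursive_in A (\<lambda>x. set_encode {k. k < b x \<and> P x k})"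
proof -
  have *: "{k. k < Suc n \<and> P x k} = (if P x n then insert n {k. k < n \<and> P x k} else {k. k < n \<and> P x k})"
    for x n by (auto simp: less_Suc_eq)
  have "rec_nat 0 (\<lambda>m r. if P x m then 2 ^ m + r else r) n = set_encode {k. k < n \<and> P x k}" for x n
    by (induction n) (auto simp: *)
  then have "(\<lambda>x. set_encode {k. k < b x \<and> P x k})
      = (\<lambda>x. rec_nat 0 (\<lambda>m r. if P x m then 2 ^ m + r else r) (b x))"
    by (simp only:)
  moreover have "decidable_in A (\<lambda>p. P (pfst p) (pfst (psnd p)))"
    by (rule recursive_comp2[OF assms(1) recursive_pfst[OF recursive_id]
          recursive_pfst[OF recursive_psnd[OF recursive_id]]])
  ultimately show ?thesis using assms(2) by (simp only:) (intro recI)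
qed

lemma mem_set_decode_less: "n \<in> set_decode k \<Longrightarrow> n < k"
proof -
  assume "n \<in> set_decode k"
  then have "k div 2 ^ n \<noteq> 0" by (auto simp: set_decode_def intro: ccontr)
  then have "2 ^ n \<le> k" by (meson div_less not_le)
  then show "n < k" using less_exp[of n] by linarith
qed

section \<open>Coded derivations and the enumeration theorem\<close>

text \<open>
  The elements \<open>\<langle>e, \<langle>x, y\<rangle>\<rangle>\<close> of a derivation state that program \<open>e\<close> maps \<open>x\<close> to \<open>y\<close>.  A justification
  only appeals to facts that are smaller in the lexicographic order on \<open>(e, x)\<close>, so derivations need not be
  ordered: a finite set in which each fact is justified by others is automatically sound.
  Every oracle query of a derivation with code \<open>c\<close> is below \<open>c\<close>.
\<close>

definition justified :: "nat set \<Rightarrow> nat set \<Rightarrow> nat \<Rightarrow> nat \<Rightarrow> nat \<Rightarrow> bool" where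
  "justified X D e x y \<longleftrightarrow>
     e = 0 \<and> y = 0 \<or> e = 1 \<and> y = Suc x \<or> e = 2 \<and> y = pfst x \<or> e = 3 \<and> y = psnd x \<or>
     e = 4 \<and> y = of_bool (x \<in> X) \<or>
     5 \<le> e \<and> (e - 5) mod 4 = 0 \<and> pair (pfst ((e - 5) div 4)) (pair x (pfst y)) \<in> D \<and>
       pair (psnd ((e - 5) div 4)) (pair x (psnd y)) \<in> D \<or>
     5 \<le> e \<and> (e - 5) mod 4 = 1 \<and>
       (\<exists>u. pair (psnd ((e - 5) div 4)) (pair x u) \<in> D \<and> pair (pfst ((e - 5) div 4)) (pair u y) \<in> D) \<or>
     5 \<le> e \<and> (e - 5) mod 4 = 2 \<and>
       (if psnd x = 0 then pair (pfst ((e - 5) div 4)) (pair (pfst x) y) \<in> D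
        else \<exists>v. pair e (pair (pair (pfst x) (psnd x - 1)) v) \<in> D \<and>
          pair (psnd ((e - 5) div 4)) (pair (pair (pfst x) (pair (psnd x - 1) v)) y) \<in> D) \<or>
     5 \<le> e \<and> (e - 5) mod 4 = 3 \<and> pair ((e - 5) div 4) (pair (pair x y) 0) \<in> D \<and>
       (\<forall>m<y. \<exists>v. 0 < v \<and> pair ((e - 5) div 4) (pair (pair x m) v) \<in> D)"

definition derivation :: "nat set \<Rightarrow> nat set \<Rightarrow> bool" where
  "derivation X D \<longleftrightarrow> (\<forall>t\<in>D. justified X D (pfst t) (pfst (psnd t)) (psnd (psnd t)))"

lemma div_mod_4_simps:
  fixes q :: nat
  shows "(4 * q + 5 - 5) mod 4 = 0" "(4 * q + 5 - 5) div 4 = q"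
    "(4 * q + 6 - 5) mod 4 = 1" "(4 * q + 6 - 5) div 4 = q"
    "(4 * q + 7 - 5) mod 4 = 2" "(4 * q + 7 - 5) div 4 = q"
    "(4 * q + 8 - 5) mod 4 = 3" "(4 * q + 8 - 5) div 4 = q"
proof -
  have "4 * q + 6 - 5 = 1 + 4 * q" "4 * q + 7 - 5 = 2 + 4 * q" "4 * q + 8 - 5 = 3 + 4 * q" by auto
  then show "(4 * q + 5 - 5) mod 4 = 0" "(4 * q + 5 - 5) div 4 = q"
    "(4 * q + 6 - 5) mod 4 = 1" "(4 * q + 6 - 5) div 4 = q"
    "(4 * q + 7 - 5) mod 4 = 2" "(4 * q + 7 - 5) div 4 = q"
    "(4 * q + 8 - 5) mod 4 = 3" "(4 * q + 8 - 5) div 4 = q"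
    by (simp_all only: mod_mult_self2 div_mult_self2) simp_all
qed

lemma justified_goedel:
  "justified X D (goedel Zero) x y \<longleftrightarrow> y = 0"
  "justified X D (goedel Succ) x y \<longleftrightarrow> y = Suc x"
  "justified X D (goedel Fst) x y \<longleftrightarrow> y = pfst x"
  "justified X D (goedel Snd) x y \<longleftrightarrow> y = psnd x"
  "justified X D (goedel Oracle) x y \<longleftrightarrow> y = of_bool (x \<in> X)"
  "justified X D (goedel (Tuple f g)) x y \<longleftrightarrow>
     pair (goedel f) (pair x (pfst y)) \<in> D \<and> pair (goedel g) (pair x (psnd y)) \<in> D"
  "justified X D (goedel (Comp f g)) x y \<longleftrightarrow>
     (\<exists>u. pair (goedel g) (pair x u) \<in> D \<and> pair (goedel f) (pair u y) \<in> D)"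
  "justified X D (goedel (Prec f g)) x y \<longleftrightarrow>
     (if psnd x = 0 then pair (goedel f) (pair (pfst x) y) \<in> D
      else \<exists>v. pair (goedel (Prec f g)) (pair (pair (pfst x) (psnd x - 1)) v) \<in> D \<and>
        pair (goedel g) (pair (pair (pfst x) (pair (psnd x - 1) v)) y) \<in> D)"
  "justified X D (goedel (Mu f)) x y \<longleftrightarrow> pair (goedel f) (pair (pair x y) 0) \<in> D \<and>
     (\<forall>m<y. \<exists>v. 0 < v \<and> pair (goedel f) (pair (pair x m) v) \<in> D)"
  unfolding justified_def goedel.simps div_mod_4_simps by simp_all

lemma justified_mono: "justified X D e x y \<Longrightarrow> D \<subseteq> E \<Longrightarrow> justified X E e x y"
  unfolding justified_def by (elim disjE; simp split: if_splits; blast)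

lemma derivation_justified:
  "derivation X D \<Longrightarrow> pair e (pair x y) \<in> D \<Longrightarrow> justified X D e x y"
  unfolding derivation_def by (metis fst_conv prod_encode_inverse snd_conv)

lemma derivation_Un: "derivation X D \<Longrightarrow> derivation X E \<Longrightarrow> derivation X (D \<union> E)"
  unfolding derivation_def by (meson Un_iff justified_mono sup_ge1 sup_ge2)

lemma derivation_insert:
  "derivation X D \<Longrightarrow> justified X D e x y \<Longrightarrow> derivation X (insert (pair e (pair x y)) D)"
  unfolding derivation_def by (auto intro: justified_mono)

text \<open>Induction on the program, and for \<open>Prec\<close>, whose facts may rest on facts
  about the same program, a second induction on the recursion argument. This follows the
  lexicographic descent of justifications, so facts cannot support each other in a circle.\<close>

lemma derivation_sound:
  "derivation X D \<Longrightarrow> pair (goedel f) (pair x y) \<in> D \<Longrightarrow> run X f x = Some y"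
proof (induction f arbitrary: x y)
  case (Tuple f g)
  have "pair (goedel f) (pair x (pfst y)) \<in> D" "pair (goedel g) (pair x (psnd y)) \<in> D"
    using derivation_justified[OF Tuple.prems] by (simp_all only: justified_goedel)
  then show ?case using Tuple.IH[OF Tuple.prems(1)] by simp
next
  case (Comp f g)
  then show ?case using derivation_justified[OF Comp.prems]
    by (auto simp add: justified_goedel simp del: goedel.simps)
next
  case (Prec f g)
  define a where "a = pfst x"
  have "pair (goedel (Prec f g)) (pair (pair a n) z) \<in> D \<Longrightarrow>
      rec_nat (run X f a) (\<lambda>m r. Option.bind r (\<lambda>v. run X g (pair a (pair m v)))) n = Some z" for n z
  proof (induction n arbitrary: z)
    case 0
    then show ?case using derivation_justified[OF Prec.prems(1) 0] Prec.IH(1)[OF Prec.prems(1)]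
      by (simp add: justified_goedel del: goedel.simps)
  next
    case (Suc n)
    obtain v where v: "pair (goedel (Prec f g)) (pair (pair a n) v) \<in> D"
      "pair (goedel g) (pair (pair a (pair n v)) z) \<in> D"
      using derivation_justified[OF Prec.prems(1) Suc.prems]
      by (auto simp add: justified_goedel simp del: goedel.simps)
    then show ?case using Suc.IH[OF v(1)] Prec.IH(2)[OF Prec.prems(1) v(2)] by simp
  qed
  from this[of "psnd x" y] show ?case using Prec.prems(2) by (simp add: a_def)
next
  case (Mu f)
  have *: "pair (goedel f) (pair (pair x y) 0) \<in> D"
    "\<forall>m<y. \<exists>v. 0 < v \<and> pair (goedel f) (pair (pair x m) v) \<in> D"
    using derivation_justified[OF Mu.prems] by (simp_all add: justified_goedel del: goedel.simps)
  have r: "run X f (pair x y) = Some 0" using Mu.IH[OF Mu.prems(1) *(1)] .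
  have p: "\<exists>v>0. run X f (pair x m) = Some v" if "m < y" for m
    using *(2) that Mu.IH[OF Mu.prems(1)] by blast
  have least: "(LEAST n. run X f (pair x n) = Some 0) = y"
  proof (rule Least_equality, rule r)
    show "y \<le> z" if "run X f (pair x z) = Some 0" for z
      using p[of z] that by (force simp: not_less[symmetric])
  qed
  have "\<exists>n. run X f (pair x n) = Some 0 \<and> (\<forall>m<n. run X f (pair x m) \<noteq> None)"
    using r p by (intro exI[of _ y]) auto
  then show ?case by (simp add: least)
qed (use derivation_justified in \<open>fastforce simp add: justified_goedel simp del: goedel.simps\<close>)+

definition derivable :: "nat set \<Rightarrow> nat \<Rightarrow> bool" where
  "derivable X t \<longleftrightarrow> (\<exists>D. finite D \<and> derivation X D \<and> t \<in> D)"

lemma derivable_finite: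
  assumes "finite F" "\<And>t. t \<in> F \<Longrightarrow> derivable X t"
  shows "\<exists>D. finite D \<and> derivation X D \<and> F \<subseteq> D"
  using assms
proof (induction F rule: finite_induct)
  case empty
  then show ?case by (auto simp: derivation_def)
next
  case (insert t F)
  then obtain D where D: "finite D" "derivation X D" "F \<subseteq> D" by blast
  obtain E where E: "finite E" "derivation X E" "t \<in> E"
    using insert.prems[of t] unfolding derivable_def by blast
  show ?case using D E by (intro exI[of _ "D \<union> E"]) (auto intro: derivation_Un)
qed

text \<open>Derivations are closed under unions, so the finitely many facts used in one
  justification fit into a single derivation, to which the new fact is added.\<close>

lemma derivable_step:
  assumes "finite F" "\<And>t. t \<in> F \<Longrightarrow> derivable X t" "justified X F e x y"
  shows "derivable X (pair e (pair x y))"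
proof -
  obtain D where D: "finite D" "derivation X D" "F \<subseteq> D" using derivable_finite assms by meson
  then show ?thesis unfolding derivable_def
    using assms(3) derivation_insert justified_mono by (meson finite_insert insertI1)
qed

lemma derivation_complete: "run X f x = Some y \<Longrightarrow> derivable X (pair (goedel f) (pair x y))"
proof (induction f arbitrary: x y)
  case (Tuple f g)
  then obtain u v where uv: "run X f x = Some u" "run X g x = Some v" "y = pair u v"
    by (auto simp: bind_eq_Some_conv)
  show ?case
    by (rule derivable_step[of "{pair (goedel f) (pair x u), pair (goedel g) (pair x v)}"])
      (use Tuple.IH(1)[OF uv(1)] Tuple.IH(2)[OF uv(2)] in \<open>auto simp: justified_goedel uv(3) simp del: goedel.simps\<close>)
next
  case (Comp f g)
  then obtain u where u: "run X g x = Some u" "run X f u = Some y" by (auto simp: bind_eq_Some_conv)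
  show ?case
    by (rule derivable_step[of "{pair (goedel g) (pair x u), pair (goedel f) (pair u y)}"])
      (use Comp.IH(1)[OF u(2)] Comp.IH(2)[OF u(1)] in \<open>auto simp: justified_goedel simp del: goedel.simps\<close>)
next
  case (Prec f g)
  define a where "a = pfst x"
  have "rec_nat (run X f a) (\<lambda>m r. Option.bind r (\<lambda>v. run X g (pair a (pair m v)))) n = Some z \<Longrightarrow>
      derivable X (pair (goedel (Prec f g)) (pair (pair a n) z))" for n z
  proof (induction n arbitrary: z)
    case 0
    then show ?case
      by (intro derivable_step[of "{pair (goedel f) (pair a z)}"])
        (use Prec.IH(1)[of a z] in \<open>auto simp: justified_goedel simp del: goedel.simps\<close>)
  next
    case (Suc n)
    then obtain v where v: "rec_nat (run X f a) (\<lambda>m r. Option.bind r (\<lambda>v. run X g (pair a (pair m v)))) n = Some v"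
      "run X g (pair a (pair n v)) = Some z" by (auto simp: bind_eq_Some_conv)
    show ?case
      by (rule derivable_step[of "{pair (goedel (Prec f g)) (pair (pair a n) v),
            pair (goedel g) (pair (pair a (pair n v)) z)}"])
        (use Suc.IH[OF v(1)] Prec.IH(2)[OF v(2)] in \<open>auto simp: justified_goedel simp del: goedel.simps\<close>)
  qed
  from this[of "psnd x" y] show ?case using Prec.prems by (simp add: a_def)
next
  case (Mu f)
  define P where "P n \<longleftrightarrow> run X f (pair x n) = Some 0" for n
  obtain n where n: "P n" "\<forall>m<n. run X f (pair x m) \<noteq> None" and y: "y = (LEAST n. P n)"
    using Mu.prems by (auto split: if_splits simp: P_def)
  \<comment> \<open>The zero \<open>n\<close> given by the semantics of \<open>Mu\<close> has only
    defined values before it. The least zero \<open>y\<close> is not beyond \<open>n\<close>, so the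
    values before \<open>y\<close> are defined and positive.\<close>
  have "y \<le> n" using y n by (simp add: Least_le)
  have 0: "run X f (pair x y) = Some 0" using LeastI[of P n] n y P_def by simp
  have "\<exists>v>0. run X f (pair x m) = Some v" if "m < y" for m
    using that not_less_Least[of m P] y n \<open>y \<le> n\<close> P_def
    by (metis gr0I less_le_trans option.exhaust)
  then obtain v where v: "\<And>m. m < y \<Longrightarrow> 0 < v m \<and> run X f (pair x m) = Some (v m)" by metis
  show ?case
    by (rule derivable_step[of "insert (pair (goedel f) (pair (pair x y) 0))
          ((\<lambda>m. pair (goedel f) (pair (pair x m) (v m))) ` {..<y})"])
      (use 0 v Mu.IH in \<open>auto simp: justified_goedel simp del: goedel.simps\<close>)
qed (rule derivable_step[of "{}"]; auto simp: justified_goedel simp del: goedel.simps)+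

section \<open>Coded computations and their use\<close>

definition computes :: "nat set \<Rightarrow> nat \<Rightarrow> nat \<Rightarrow> nat \<Rightarrow> nat \<Rightarrow> bool" where
  "computes X e x y c \<longleftrightarrow> derivation X (set_decode c) \<and> pair e (pair x y) \<in> set_decode c"

text \<open>The bound \<open>y<c\<close> holds automatically, as every component of a fact is below
  the code of a set containing it; it makes the predicate decidable.\<close>

definition halts :: "nat set \<Rightarrow> nat \<Rightarrow> nat \<Rightarrow> nat \<Rightarrow> bool" where
  "halts X e x c \<longleftrightarrow> (\<exists>y<c. computes X e x y c)"

lemma run_eq_Some_iff: "run X f x = Some y \<longleftrightarrow> (\<exists>c. computes X (goedel f) x y c)"
proof
  assume "run X f x = Some y"
  then obtain D where "finite D" "derivation X D" "pair (goedel f) (pair x y) \<in> D"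
    using derivation_complete derivable_def by meson
  then show "\<exists>c. computes X (goedel f) x y c"
    by (auto simp: computes_def intro!: exI[of _ "set_encode D"])
qed (auto simp: computes_def dest: derivation_sound)

lemma pair_pair_le: "x \<le> pair e (pair x y)" "y \<le> pair e (pair x y)" "e \<le> pair e (pair x y)"
  by (meson le_prod_encode_1 le_prod_encode_2 order_trans)+

lemma fact_less:
  assumes "pair e (pair x y) \<in> set_decode c" shows "e < c" "x < c" "y < c"
  using mem_set_decode_less[OF assms] pair_pair_le[of x e y] pair_pair_le(2)[of y e x]
    pair_pair_le(3)[of e x y] by linarith+

lemma run_eq_None_iff: "run X f x \<noteq> None \<longleftrightarrow> (\<exists>c. halts X (goedel f) x c)"
  by (auto simp: run_eq_Some_iff halts_def computes_def dest: fact_less)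

lemma jump_iff: "e \<in> jump X \<longleftrightarrow> (\<exists>c. halts X e e c)"
  using run_eq_None_iff surj_goedel[of e] unfolding jump_def by blast

text \<open>The use principle: a query is the argument of some fact of the derivation and therefore
  below the code \<open>c\<close>.\<close>

lemma derivation_local:
  assumes "X \<inter> {..<c} = Y \<inter> {..<c}"
  shows "derivation X (set_decode c) \<longleftrightarrow> derivation Y (set_decode c)"
proof -
  have "justified X (set_decode c) (pfst t) (pfst (psnd t)) (psnd (psnd t)) \<longleftrightarrow>
      justified Y (set_decode c) (pfst t) (pfst (psnd t)) (psnd (psnd t))" if "t \<in> set_decode c" for t
  proof -
    have "pfst (psnd t) < c" using fact_less(2)[of "pfst t" "pfst (psnd t)" "psnd (psnd t)" c] that by simp
    then have "pfst (psnd t) \<in> X \<longleftrightarrow> pfst (psnd t) \<in> Y" using assms by auto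
    then show ?thesis unfolding justified_def by simp
  qed
  then show ?thesis unfolding derivation_def by blast
qed

lemma computes_local:
  "X \<inter> {..<c} = Y \<inter> {..<c} \<Longrightarrow> computes X e x y c \<longleftrightarrow> computes Y e x y c"
  unfolding computes_def using derivation_local by blast

lemma halts_local:
  "X \<inter> {..<c} = Y \<inter> {..<c} \<Longrightarrow> halts X e x c \<longleftrightarrow> halts Y e x c"
  unfolding halts_def using computes_local by blast

lemma Ex_bounded: "(\<And>k. P k \<Longrightarrow> k < (b::nat)) \<Longrightarrow> (\<exists>k. P k) \<longleftrightarrow> (\<exists>k<b. P k)"
  by blast

text \<open>Prepares decidability: the values searched for are components of coded facts, hence
  below \<open>c\<close>.\<close>

lemma justified_bounded:
  "justified X (set_decode c) e x y \<longleftrightarrow>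
     e = 0 \<and> y = 0 \<or> e = 1 \<and> y = Suc x \<or> e = 2 \<and> y = pfst x \<or> e = 3 \<and> y = psnd x \<or>
     e = 4 \<and> y = of_bool (x \<in> X) \<or>
     5 \<le> e \<and> (e - 5) mod 4 = 0 \<and> pair (pfst ((e - 5) div 4)) (pair x (pfst y)) \<in> set_decode c \<and>
       pair (psnd ((e - 5) div 4)) (pair x (psnd y)) \<in> set_decode c \<or>
     5 \<le> e \<and> (e - 5) mod 4 = 1 \<and>
       (\<exists>u<c. pair (psnd ((e - 5) div 4)) (pair x u) \<in> set_decode c \<and>
          pair (pfst ((e - 5) div 4)) (pair u y) \<in> set_decode c) \<or>
     5 \<le> e \<and> (e - 5) mod 4 = 2 \<and>
       (if psnd x = 0 then pair (pfst ((e - 5) div 4)) (pair (pfst x) y) \<in> set_decode c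
        else \<exists>v<c. pair e (pair (pair (pfst x) (psnd x - 1)) v) \<in> set_decode c \<and>
          pair (psnd ((e - 5) div 4)) (pair (pair (pfst x) (pair (psnd x - 1) v)) y) \<in> set_decode c) \<or>
     5 \<le> e \<and> (e - 5) mod 4 = 3 \<and> pair ((e - 5) div 4) (pair (pair x y) 0) \<in> set_decode c \<and>
       (\<forall>m<y. \<exists>v<c. 0 < v \<and> pair ((e - 5) div 4) (pair (pair x m) v) \<in> set_decode c)"
proof -
  have 1: "(\<exists>u. pair (psnd ((e - 5) div 4)) (pair x u) \<in> set_decode c \<and>
      pair (pfst ((e - 5) div 4)) (pair u y) \<in> set_decode c) \<longleftrightarrow>
    (\<exists>u<c. pair (psnd ((e - 5) div 4)) (pair x u) \<in> set_decode c \<and>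
      pair (pfst ((e - 5) div 4)) (pair u y) \<in> set_decode c)"
    by (rule Ex_bounded) (auto dest: fact_less)
  have 2: "(\<exists>v. pair e (pair (pair (pfst x) (psnd x - 1)) v) \<in> set_decode c \<and>
      pair (psnd ((e - 5) div 4)) (pair (pair (pfst x) (pair (psnd x - 1) v)) y) \<in> set_decode c) \<longleftrightarrow>
    (\<exists>v<c. pair e (pair (pair (pfst x) (psnd x - 1)) v) \<in> set_decode c \<and>
      pair (psnd ((e - 5) div 4)) (pair (pair (pfst x) (pair (psnd x - 1) v)) y) \<in> set_decode c)"
    by (rule Ex_bounded) (auto dest: fact_less)
  have 3: "(\<exists>v. 0 < v \<and> pair ((e - 5) div 4) (pair (pair x m) v) \<in> set_decode c) \<longleftrightarrow>
    (\<exists>v<c. 0 < v \<and> pair ((e - 5) div 4) (pair (pair x m) v) \<in> set_decode c)" for m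
    by (rule Ex_bounded) (auto dest: fact_less)
  show ?thesis unfolding justified_def 1 2 3 ..
qed

lemma decidable_derivation [recI]:
  assumes "recursive_in A k" "recursive_in A c"
  shows "decidable_in A (\<lambda>x. derivation (set_decode (k x)) (set_decode (c x)))"
proof -
  have eq: "derivation X (set_decode c) \<longleftrightarrow>
      (\<forall>t<c. t \<in> set_decode c \<longrightarrow> justified X (set_decode c) (pfst t) (pfst (psnd t)) (psnd (psnd t)))" for X c
    unfolding derivation_def using mem_set_decode_less by blast
  have "decidable_in A (\<lambda>p. derivation (set_decode (pfst p)) (set_decode (psnd p)))"
    unfolding eq justified_bounded by (intro recI)
  from recursive_comp2[OF this assms] show ?thesis .
qed

lemma decidable_computes [recI]:
  assumes "recursive_in A k" "recursive_in A e" "recursive_in A x" "recursive_in A y" "recursive_in A c"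
  shows "decidable_in A (\<lambda>z. computes (set_decode (k z)) (e z) (x z) (y z) (c z))"
  unfolding computes_def using assms by (intro recI)

lemma decidable_halts [recI]:
  assumes "recursive_in A k" "recursive_in A e" "recursive_in A x" "recursive_in A c"
  shows "decidable_in A (\<lambda>z. halts (set_decode (k z)) (e z) (x z) (c z))"
proof -
  have "decidable_in A (\<lambda>z. halts (set_decode (pfst z)) (pfst (psnd z)) (pfst (psnd (psnd z))) (psnd (psnd (psnd z))))"
    unfolding halts_def by (intro recI)
  from recursive_comp4[OF this assms] show ?thesis .
qed

section \<open>Turing reducibility, the jump and the limit lemma\<close>

text \<open>Oracle queries are answered by the program \<open>q\<close>; this yields transitivity of
  Turing reducibility.\<close>

primrec oracle_subst :: "recf \<Rightarrow> recf \<Rightarrow> recf" where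
  "oracle_subst q Zero = Zero"
| "oracle_subst q Succ = Succ"
| "oracle_subst q Fst = Fst"
| "oracle_subst q Snd = Snd"
| "oracle_subst q Oracle = q"
| "oracle_subst q (Tuple f g) = Tuple (oracle_subst q f) (oracle_subst q g)"
| "oracle_subst q (Comp f g) = Comp (oracle_subst q f) (oracle_subst q g)"
| "oracle_subst q (Prec f g) = Prec (oracle_subst q f) (oracle_subst q g)"
| "oracle_subst q (Mu f) = Mu (oracle_subst q f)"

lemma run_oracle_subst:
  assumes "\<And>x. run B q x = Some (of_bool (x \<in> A))"
  shows "run B (oracle_subst q p) = run A p"
  by (induction p) (rule ext, simp add: assms)+

lemma recursive_in_Turing_le:
  assumes "recursive_in A f" "Turing_le A B"
  shows "recursive_in B f"
proof -
  obtain p where p: "\<And>x. run A p x = Some (f x)" by (rule recursive_inE[OF assms(1)]) blast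
  obtain q where q: "\<And>x. run B q x = Some (of_bool (x \<in> A))"
    by (rule recursive_inE[OF assms(2)[unfolded Turing_le_def]]) blast
  show ?thesis by (rule recursive_inI[of _ "oracle_subst q p"]) (simp add: run_oracle_subst[OF q] p)
qed

lemma Turing_le_empty: "Turing_le {} B"
  unfolding Turing_le_def empty_iff by (intro recI)

lemma recursive_recursive_in: "recursive f \<Longrightarrow> recursive_in A f"
  using recursive_in_Turing_le Turing_le_empty by blast

lemma Turing_le_trans: "Turing_le A B \<Longrightarrow> Turing_le B C \<Longrightarrow> Turing_le A C"
  using recursive_in_Turing_le unfolding Turing_le_def by blast

lemma Turing_le_refl: "Turing_le A A"
  unfolding Turing_le_def by (intro recursive_oracle recI)

lemma halts_oracle_truncate:
  "halts A e x c \<longleftrightarrow> halts (set_decode (set_encode {k. k < c \<and> k \<in> A})) e x c"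
  by (rule halts_local) auto

lemma decidable_halts_oracle:
  assumes "recursive_in A e" "recursive_in A x" "recursive_in A c"
  shows "decidable_in A (\<lambda>z. halts A (e z) (x z) (c z))"
proof -
  have "decidable_in A (\<lambda>z. halts A (pfst z) (pfst (psnd z)) (psnd (psnd z)))"
    by (subst halts_oracle_truncate) (intro recI recursive_oracle)
  from recursive_comp3[OF this assms] show ?thesis .
qed

section \<open>Sets r.e. in an oracle, and the jump\<close>

definition re_in :: "nat set \<Rightarrow> nat set \<Rightarrow> bool" where
  "re_in A S \<longleftrightarrow> (\<exists>R. decidable_in A R \<and> S = {x. \<exists>y. R (pair x y)})"

lemma re_inI: "decidable_in A R \<Longrightarrow> (\<And>x. x \<in> S \<longleftrightarrow> (\<exists>y. R (pair x y))) \<Longrightarrow> re_in A S"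
  unfolding re_in_def by blast

lemma re_in_dom:
  assumes "re_in A S"
  obtains p where "\<And>x. run A p x \<noteq> None \<longleftrightarrow> x \<in> S"
proof -
  obtain R where R: "decidable_in A R" "S = {x. \<exists>y. R (pair x y)}" using assms re_in_def by auto
  have "recursive_in A (\<lambda>x. 1 - of_bool (R x))" using R(1) by (intro recI)
  then obtain q where q: "\<And>x. run A q x = Some (1 - of_bool (R x))" by (rule recursive_inE) blast
  have "run A (Mu q) x \<noteq> None \<longleftrightarrow> x \<in> S" for x by (auto simp: q R(2))
  then show ?thesis by (rule that)
qed

lemma re_set_re_in: "re_in {} S \<Longrightarrow> re_set S"
proof -
  assume "re_in {} S"
  from re_in_dom[OF this] obtain p where "\<And>x. run {} p x \<noteq> None \<longleftrightarrow> x \<in> S" by blast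
  then have "S = dom (run {} p)" by auto
  then show ?thesis unfolding re_set_def partial_recursive_in_def by blast
qed

lemma re_in_Turing_le: "re_in A S \<Longrightarrow> Turing_le A B \<Longrightarrow> re_in B S"
  unfolding re_in_def using recursive_in_Turing_le by blast

lemma goedel_in_jump: "goedel p \<in> jump A \<longleftrightarrow> run A p (goedel p) \<noteq> None"
  by (auto simp: jump_def dest: inj_goedel)

primrec const_recf :: "nat \<Rightarrow> recf" where
  "const_recf 0 = Zero"
| "const_recf (Suc n) = Comp Succ (const_recf n)"

lemma run_const_recf [simp]: "run A (const_recf n) x = Some n"
  by (induction n) auto

lemma recursive_goedel_const_recf: "recursive_in A (\<lambda>n. goedel (const_recf n))"
proof -
  have "goedel (const_recf n) = rec_nat 0 (\<lambda>m r. 4 * pair 1 r + 6) n" for n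
    by (induction n) auto
  then show ?thesis by (simp only:) (intro recI)
qed

text \<open>The program \<open>Comp p (const_recf x)\<close> ignores its input and runs
  \<open>p\<close> on \<open>x\<close>, so it halts on its own code iff \<open>x\<close> is in
  \<open>S\<close>. Its code is obtained from \<open>x\<close> without oracle queries, so
  \<open>g\<close> is recursive in every \<open>B\<close>.\<close>

lemma re_in_many_one:
  assumes "re_in A S"
  obtains g where "\<And>B. recursive_in B g" "\<And>x. x \<in> S \<longleftrightarrow> g x \<in> jump A"
proof -
  obtain p where p: "\<And>x. run A p x \<noteq> None \<longleftrightarrow> x \<in> S" by (rule re_in_dom[OF assms]) blast
  define g where "g x = goedel (Comp p (const_recf x))" for x
  have "recursive_in B g" for B
    unfolding g_def goedel.simps by (intro recI recursive_goedel_const_recf)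
  moreover have "x \<in> S \<longleftrightarrow> g x \<in> jump A" for x
    unfolding g_def goedel_in_jump by (simp add: p[symmetric])
  ultimately show ?thesis by (rule that)
qed

lemma re_in_le_jump: "re_in A S \<Longrightarrow> Turing_le S (jump A)"
proof -
  assume "re_in A S"
  then obtain g where "\<And>B. recursive_in B g" "\<And>x. x \<in> S \<longleftrightarrow> g x \<in> jump A"
    by (rule re_in_many_one) blast
  then show ?thesis unfolding Turing_le_def by (simp only:) (intro recursive_oracle)
qed

lemma re_in_jump: "re_in A (jump A)"
  by (rule re_inI[of _ "\<lambda>z. halts A (pfst z) (pfst z) (psnd z)"])
    (auto simp: jump_iff intro!: decidable_halts_oracle recI)

lemma re_in_decidable: "Turing_le S A \<Longrightarrow> re_in A S"
proof -
  assume "Turing_le S A"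
  then have "decidable_in A (\<lambda>z. pfst z \<in> S)"
    unfolding Turing_le_def by (rule recursive_comp) (intro recI)
  then show ?thesis by (rule re_inI) auto
qed

lemma Turing_le_jump: "Turing_le A (jump A)"
  by (intro re_in_le_jump re_in_decidable Turing_le_refl)

lemma jump_mono: "Turing_le A B \<Longrightarrow> Turing_le (jump A) (jump B)"
  using re_in_jump re_in_Turing_le re_in_le_jump by blast

text \<open>Diagonalisation: a program whose domain is the complement of the jump is run on its own
  code.\<close>

lemma jump_not_le: "\<not> Turing_le (jump A) A"
proof
  assume "Turing_le (jump A) A"
  then have "Turing_le (- jump A) A" unfolding Turing_le_def Compl_iff by (intro recI)
  then obtain p where p: "\<And>x. run A p x \<noteq> None \<longleftrightarrow> x \<in> - jump A"
    by (rule re_in_dom[OF re_in_decidable]) blast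
  show False using p[of "goedel p"] goedel_in_jump[of p A] by blast
qed

text \<open>One direction of the limit lemma. The set \<open>M\<close> of pairs at which the
  approximation will still change is r.e. in \<open>A\<close>, so the jump of \<open>A\<close> can
  find the first stage outside \<open>M\<close>; there the value is final.\<close>

lemma limit_lemma:
  assumes "decidable_in A R" "\<And>x. \<exists>s. \<forall>t\<ge>s. R (pair x t) \<longleftrightarrow> x \<in> S"
  shows "Turing_le S (jump A)"
proof -
  define M where "M = {z. \<exists>d. R (pair (pfst z) (psnd z + d)) \<noteq> R (pair (pfst z) (psnd z))}"
  have "re_in A M"
  proof (rule re_inI)
    show "decidable_in A (\<lambda>w. R (pair (pfst (pfst w)) (psnd (pfst w) + psnd w)) \<noteq>
        R (pair (pfst (pfst w)) (psnd (pfst w))))"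
      by (intro recI recursive_comp[OF assms(1)])
  qed (simp add: M_def)
  then have M: "decidable_in (jump A) (\<lambda>x. x \<in> M)" using re_in_le_jump Turing_le_def by simp
  have stab: "\<exists>s. pair x s \<notin> M" for x
  proof -
    obtain s where "\<forall>t\<ge>s. R (pair x t) \<longleftrightarrow> x \<in> S" using assms(2) by blast
    then have "pair x s \<notin> M" by (simp add: M_def)
    then show ?thesis ..
  qed
  have val: "R (pair x s) \<longleftrightarrow> x \<in> S" if "pair x s \<notin> M" for x s
  proof -
    obtain s' where s': "\<forall>t\<ge>s'. R (pair x t) \<longleftrightarrow> x \<in> S" using assms(2) by blast
    have "R (pair x (s + s')) = R (pair x s)" using that by (simp add: M_def)
    then show ?thesis using s' by simp
  qed
  have R: "decidable_in (jump A) R" using assms(1) Turing_le_jump recursive_in_Turing_le by blast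
  have "recursive_in (jump A) (\<lambda>x. LEAST s. pair x s \<notin> M)"
    by (intro recI recursive_comp[OF M]) (rule stab)
  then have "decidable_in (jump A) (\<lambda>x. R (pair x (LEAST s. pair x s \<notin> M)))"
    by (intro recursive_comp[OF R] recursive_pair recursive_id)
  moreover have "R (pair x (LEAST s. pair x s \<notin> M)) \<longleftrightarrow> x \<in> S" for x
    using val LeastI_ex[OF stab] by blast
  ultimately show ?thesis unfolding Turing_le_def by simp
qed

section \<open>The inner construction\<close>

type_synonym event = "nat set \<Rightarrow> nat \<Rightarrow> nat \<Rightarrow> nat \<Rightarrow> bool"

text \<open>
  An element \<open>\<langle>i, s\<rangle>\<close> of \<open>G\<close> records that \<open>i\<close> entered \<open>B\<close> at stage \<open>s\<close>; the location coding \<open>n \<in> K\<close>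
  into \<open>A\<close> is \<open>\<langle>n, marker G n\<rangle>\<close>.
\<close>

definition marker :: "nat set \<Rightarrow> nat \<Rightarrow> nat" where
  "marker G n = (LEAST g. \<forall>e\<in>G. pfst e \<le> n \<longrightarrow> psnd e < g)"

text \<open>
  Reading the coding locations only below \<open>t\<close> ensures that stage \<open>t\<close> depends on \<open>A\<close> below \<open>t\<close> alone.
\<close>

definition trusted :: "nat set \<Rightarrow> nat \<Rightarrow> nat \<Rightarrow> bool" where
  "trusted G t u \<longleftrightarrow> u \<le> t \<and> (\<forall>n<u. pair n (marker G n) < t)"

text \<open>
  \<open>Q X m x u\<close> is the event number \<open>x\<close> of level \<open>m\<close>, witnessed by \<open>X\<close> below \<open>u\<close>.  Events are ordered
  lexicographically by \<open>(m, x)\<close>, the first one having the highest priority.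
\<close>

definition occurs :: "event \<Rightarrow> nat set \<Rightarrow> nat set \<Rightarrow> nat \<Rightarrow> nat \<Rightarrow> nat \<Rightarrow> nat \<Rightarrow> bool" where
  "occurs Q A G t m x u \<longleftrightarrow> trusted G t u \<and> Q {n. n < u \<and> pair n (marker G n) \<in> A} m x u"

text \<open>Here \<open>y\<close> lies beyond the current restraint, that is the least witness, of
  each occurring event of higher or equal priority. The bounds by \<open>t\<close> turn this into a
  finite check.\<close>

definition observes :: "event \<Rightarrow> nat set \<Rightarrow> nat set \<Rightarrow> nat \<Rightarrow> nat \<Rightarrow> nat \<Rightarrow> nat \<Rightarrow> bool" where
  "observes Q A G t m x y \<longleftrightarrow> (\<forall>m'\<le>m. \<forall>x'\<le>t. m' < m \<or> x' \<le> x \<longrightarrow>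
     (\<forall>u\<le>t. occurs Q A G t m' x' u \<longrightarrow> (\<exists>u'\<le>y. occurs Q A G t m' x' u')))"

abbreviation level :: "nat \<Rightarrow> nat" where "level t \<equiv> pfst (pfst t)"
abbreviation target :: "nat \<Rightarrow> nat" where "target t \<equiv> pfst (psnd (pfst t))"
abbreviation bound :: "nat \<Rightarrow> nat" where "bound t \<equiv> psnd (psnd (pfst t))"

text \<open>
  The candidate considered at stage \<open>t\<close> is \<open>pfst t = \<langle>m, \<langle>x, y\<rangle>\<rangle>\<close>.  It codes \<open>x \<in> A'\<close> on level \<open>m\<close>, and its bound \<open>y\<close>
  is the least number beyond the restraints of all events of higher or equal priority; so once these have
  stabilised, there is only one candidate for \<open>(m, x)\<close>.
\<close>

definition enters :: "event \<Rightarrow> nat set \<Rightarrow> nat set \<Rightarrow> nat \<Rightarrow> bool" where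
  "enters Q A G t \<longleftrightarrow>
     (\<forall>s<t. pair (pfst t) s \<notin> G) \<and> (\<exists>c<t. halts A (target t) (target t) c) \<and>
     (\<exists>u\<le>t. occurs Q A G t (level t) (Suc (target t)) u) \<and>
     observes Q A G t (level t) (Suc (target t)) (bound t) \<and>
     (\<forall>y<bound t. \<not> observes Q A G t (level t) (Suc (target t)) y)"

primrec entries :: "event \<Rightarrow> nat set \<Rightarrow> nat \<Rightarrow> nat set" where
  "entries Q A 0 = {}"
| "entries Q A (Suc t) = (if enters Q A (entries Q A t) t then insert (pair (pfst t) t) (entries Q A t)
     else entries Q A t)"

abbreviation entering :: "event \<Rightarrow> nat set \<Rightarrow> nat \<Rightarrow> bool" where
  "entering Q A t \<equiv> enters Q A (entries Q A t) t"

definition entered :: "event \<Rightarrow> nat set \<Rightarrow> nat set" where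
  "entered Q A = {pfst t | t. entering Q A t}"

section \<open>Uniqueness and locality of entries\<close>

lemma mem_entries: "e \<in> entries Q A t \<longleftrightarrow> (\<exists>s<t. e = pair (pfst s) s \<and> entering Q A s)"
  by (induction t) (auto simp: less_Suc_eq)

lemma finite_entries [simp]: "finite (entries Q A t)"
  by (induction t) auto

lemma entries_iff: "pair i s \<in> entries Q A t \<longleftrightarrow> s < t \<and> i = pfst s \<and> entering Q A s"
  unfolding mem_entries prod_encode_eq prod.inject by blast

lemma entries_mono: "t \<le> t' \<Longrightarrow> entries Q A t \<subseteq> entries Q A t'"
  unfolding subset_iff mem_entries using less_le_trans by blast

lemma entering_unique:
  assumes "entering Q A s" "entering Q A t" "pfst s = pfst t"
  shows "s = t"
proof -
  have "\<not> a < b" if "entering Q A a" "entering Q A b" "pfst a = pfst b" for a b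
  proof
    assume "a < b"
    then have "pair (pfst b) a \<notin> entries Q A b" using that(2) enters_def by metis
    then show False using that \<open>a < b\<close> by (simp add: entries_iff)
  qed
  then show ?thesis using assms by (metis linorder_neqE_nat)
qed

text \<open>A number enters at most once, so \<open>pfst\<close> is injective on the entering
  stages.\<close>

lemma finitely_often:
  assumes "finite F" shows "\<forall>\<^sub>F t in sequentially. entering Q A t \<longrightarrow> pfst t \<notin> F"
proof -
  have "inj_on pfst {t. entering Q A t}" using entering_unique by (auto intro: inj_onI)
  then have fin: "finite (pfst -` F \<inter> {t. entering Q A t})" using assms finite_vimage_IntI by blast
  then obtain N where "\<forall>t\<in>pfst -` F \<inter> {t. entering Q A t}. t < N"
    using finite_nat_set_iff_bounded by blast
  then show ?thesis unfolding eventually_sequentially by (intro exI[of _ N]) (force simp: not_less[symmetric])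
qed

lemma marker_cong: "(\<And>e. pfst e \<le> n \<Longrightarrow> e \<in> G \<longleftrightarrow> e \<in> H) \<Longrightarrow> marker G n = marker H n"
  unfolding marker_def by (rule arg_cong[of _ _ Least]) auto

lemma marker_greater:
  assumes "finite G" "e \<in> G" "pfst e \<le> n" shows "psnd e < marker G n"
proof -
  have "\<forall>e\<in>G. pfst e \<le> n \<longrightarrow> psnd e < Suc (Max (psnd ` G))"
    using assms(1) by (auto simp: less_Suc_eq_le)
  then have "\<forall>e\<in>G. pfst e \<le> n \<longrightarrow> psnd e < marker G n" unfolding marker_def by (rule LeastI)
  then show ?thesis using assms by blast
qed

lemma occurs_le: "occurs Q A G t m x u \<Longrightarrow> u \<le> t"
  by (simp add: occurs_def trusted_def)

lemma occurs_local:
  assumes "A \<inter> {..<t} = B \<inter> {..<t}"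
  shows "occurs Q A G t m x u \<longleftrightarrow> occurs Q B G t m x u"
proof -
  have "trusted G t u \<Longrightarrow> {n. n < u \<and> pair n (marker G n) \<in> A} = {n. n < u \<and> pair n (marker G n) \<in> B}"
    using assms unfolding trusted_def by blast
  then show ?thesis by (cases "trusted G t u") (simp_all add: occurs_def)
qed

lemma Int_lessThan_mono:
  fixes A B :: "nat set"
  shows "A \<inter> {..<t} = B \<inter> {..<t} \<Longrightarrow> c \<le> t \<Longrightarrow> A \<inter> {..<c} = B \<inter> {..<c}"
  unfolding set_eq_iff by (metis Int_iff lessThan_iff less_le_trans)

text \<open>Computations with code below \<open>t\<close> query only numbers below \<open>t\<close>,
  and trusted events read only coding locations below \<open>t\<close>.\<close>

lemma enters_local:
  assumes "A \<inter> {..<t} = B \<inter> {..<t}"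
  shows "enters Q A G t \<longleftrightarrow> enters Q B G t"
proof -
  have "halts A x x c \<longleftrightarrow> halts B x x c" if "c < t" for x c
    using halts_local[OF Int_lessThan_mono[OF assms]] that by simp
  then show ?thesis unfolding enters_def observes_def occurs_local[OF assms] by meson
qed

lemma entries_local: "A \<inter> {..<t} = B \<inter> {..<t} \<Longrightarrow> entries Q A t = entries Q B t"
proof (induction t)
  case (Suc t)
  have eq: "A \<inter> {..<t} = B \<inter> {..<t}" using Int_lessThan_mono[OF Suc.prems] by simp
  show ?case using Suc.IH[OF eq] enters_local[OF eq] by simp
qed simp

text \<open>The assumption \<open>coded\<close> says that \<open>K\<close> can be read off from
  \<open>A\<close> in the limit at the current markers; the outer construction supplies such an
  \<open>A\<close>. By \<open>Q_Suc\<close> the events of a level become harder from number 1 on, so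
  one that never happens rules out all later ones.\<close>

locale inner_construction =
  fixes Q :: event and A K :: "nat set"
  assumes Q_local: "\<And>X Y u m x. X \<inter> {..<u} = Y \<inter> {..<u} \<Longrightarrow> Q X m x u \<longleftrightarrow> Q Y m x u"
    and Q_le: "\<And>X m x u. Q X m x u \<Longrightarrow> x \<le> u"
    and Q_Suc: "\<And>X m x u. Q X m (Suc (Suc x)) u \<Longrightarrow> Q X m (Suc x) u"
    and coded: "\<And>n. \<forall>\<^sub>F t in sequentially. n \<in> K \<longleftrightarrow> pair n (marker (entries Q A t) n) \<in> A"
begin

section \<open>Convergence of the restraints\<close>

abbreviation E :: "nat \<Rightarrow> bool" where "E t \<equiv> entering Q A t"
abbreviation G :: "nat \<Rightarrow> nat set" where "G t \<equiv> entries Q A t"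
abbreviation occ :: "nat \<Rightarrow> nat \<Rightarrow> nat \<Rightarrow> nat \<Rightarrow> bool" where "occ t \<equiv> occurs Q A (G t) t"

text \<open>Stage \<open>t\<close> has the correct restraint: the least witnesses agree, or neither
  side has a witness.\<close>

definition settled :: "nat \<Rightarrow> nat \<Rightarrow> nat \<Rightarrow> bool" where
  "settled t m x \<longleftrightarrow> (\<forall>y. (\<exists>u\<le>y. occ t m x u) \<longleftrightarrow> (\<exists>u\<le>y. Q K m x u))"

lemma settledD: "settled t m x \<Longrightarrow> (\<exists>u. occ t m x u) \<longleftrightarrow> (\<exists>u. Q K m x u)"
  unfolding settled_def by blast

lemma Q_antimono: "Q X m (Suc x) u \<Longrightarrow> x' \<le> x \<Longrightarrow> Q X m (Suc x') u"
proof (induction x)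
  case (Suc x)
  then show ?case using Q_Suc[of X m x u] by (cases "x' = Suc x") auto
qed simp

lemma occ_antimono: "occ t m (Suc x) u \<Longrightarrow> x' \<le> x \<Longrightarrow> occ t m (Suc x') u"
  unfolding occurs_def using Q_antimono by blast

lemma marker_stable:
  assumes "t \<le> t'" "\<And>s. t \<le> s \<Longrightarrow> s < t' \<Longrightarrow> E s \<Longrightarrow> n < pfst s"
  shows "marker (G t') n = marker (G t) n"
proof (rule marker_cong)
  fix e assume e: "pfst e \<le> n"
  show "e \<in> G t' \<longleftrightarrow> e \<in> G t"
  proof
    assume "e \<in> G t'"
    then obtain s where s: "e = pair (pfst s) s" "s < t'" "E s" unfolding mem_entries by blast
    then have "s < t" using assms(2)[of s] e by (simp add: not_less[symmetric]) (meson not_less)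
    then show "e \<in> G t" unfolding mem_entries using s by blast
  qed (use entries_mono assms(1) in blast)
qed

text \<open>Once no number below \<open>U\<close> enters any more, the markers below
  \<open>U\<close> are fixed; from some later stage on, the approximation to \<open>K\<close> below
  \<open>U\<close> is correct and trusted. Events witnessed below \<open>U\<close> depend on nothing
  else, which gives uniformity in \<open>m\<close> and \<open>x\<close>.\<close>

lemma eventually_agree:
  "\<forall>\<^sub>F t in sequentially. \<forall>m x. \<forall>u\<le>U. occ t m x u \<longleftrightarrow> Q K m x u"
proof -
  obtain T where T: "\<And>t. t \<ge> T \<Longrightarrow> E t \<Longrightarrow> pfst t \<notin> {..<U}"
    using finitely_often[of "{..<U}" Q A] by (auto simp: eventually_sequentially)
  have mk: "marker (G t) n = marker (G T) n" if "T \<le> t" "n < U" for t n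
    using that T by (intro marker_stable) (auto simp: not_less intro: less_le_trans)
  have 1: "\<forall>\<^sub>F t in sequentially. \<forall>n<U. n \<in> K \<longleftrightarrow> pair n (marker (G t) n) \<in> A"
    using eventually_ball_finite[of "{..<U}" "\<lambda>t n. n \<in> K \<longleftrightarrow> pair n (marker (G t) n) \<in> A" sequentially]
      coded by (simp add: Ball_def)
  have 2: "\<forall>\<^sub>F t in sequentially. \<forall>n<U. pair n (marker (G T) n) < t"
    using eventually_ball_finite[of "{..<U}" "\<lambda>t n. pair n (marker (G T) n) < t" sequentially]
      eventually_gt_at_top by (auto simp: Ball_def)
  from 1 2 eventually_ge_at_top[of T] eventually_ge_at_top[of U] show ?thesis
  proof eventually_elim
    case (elim t)
    show ?case
    proof (intro allI impI)
      fix m x u assume u: "u \<le> U"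
      have "trusted (G t) t u" using elim u mk[OF elim(3)] unfolding trusted_def by auto
      moreover have "Q {n. n < u \<and> pair n (marker (G t) n) \<in> A} m x u \<longleftrightarrow> Q K m x u"
        using elim(1) u by (intro Q_local) auto
      ultimately show "occ t m x u \<longleftrightarrow> Q K m x u" by (simp add: occurs_def)
    qed
  qed
qed

text \<open>An occurrence reads only the locations of numbers below \<open>u\<close>, and the entry
  of a number that is at least \<open>u\<close> moves none of their markers.\<close>

lemma occ_Suc:
  assumes "occ t m x u" "E t \<Longrightarrow> u \<le> pfst t" "u' \<le> u"
  shows "occ (Suc t) m x u' \<longleftrightarrow> occ t m x u'"
proof -
  have mk: "marker (G (Suc t)) n = marker (G t) n" if "n < u" for n
    using that assms(2) by (intro marker_stable) (auto simp: not_less_eq_eq less_Suc_eq dest!: le_antisym)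
  have "trusted (G t) t u'" using assms unfolding occurs_def trusted_def by auto
  moreover have "trusted (G (Suc t)) (Suc t) u'"
    using calculation mk assms(3) unfolding trusted_def by (auto intro: less_SucI)
  moreover have "{n. n < u' \<and> pair n (marker (G (Suc t)) n) \<in> A} = {n. n < u' \<and> pair n (marker (G t) n) \<in> A}"
    using mk assms(3) by auto
  ultimately show ?thesis unfolding occurs_def by simp
qed

lemma true_settled:
  assumes "Q K m x u" shows "\<forall>\<^sub>F t in sequentially. settled t m x"
  using eventually_agree[of u]
proof eventually_elim
  case (elim t)
  show ?case unfolding settled_def
  proof (intro allI iffI)
    fix y assume "\<exists>u\<le>y. occ t m x u"
    then show "\<exists>u\<le>y. Q K m x u" using elim assms by (meson le_trans linear)
  next
    fix y assume "\<exists>u\<le>y. Q K m x u"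
    then show "\<exists>u\<le>y. occ t m x u" using elim assms by (meson le_trans linear)
  qed
qed

text \<open>If late entries respect the restraint, an occurrence at a late stage persists forever
  with its least witness. The approximation is eventually correct below that witness, so the event
  is true of \<open>K\<close>. Hence a false event has no late occurrences.\<close>

lemma respected_settled:
  assumes "\<forall>\<^sub>F t in sequentially. E t \<longrightarrow> (\<forall>u. occ t m x u \<longrightarrow> (\<exists>u'\<le>pfst t. occ t m x u'))"
  shows "\<forall>\<^sub>F t in sequentially. settled t m x"
proof (cases "\<exists>u. Q K m x u")
  case True
  then show ?thesis using true_settled by blast
next
  case False
  obtain T where T: "\<And>t u. t \<ge> T \<Longrightarrow> E t \<Longrightarrow> occ t m x u \<Longrightarrow> \<exists>u'\<le>pfst t. occ t m x u'"
    using assms unfolding eventually_sequentially by blast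
  have "\<not> occ t m x u" if "T \<le> t" for t u
  proof
    assume "occ t m x u"
    define v where "v = (LEAST u. occ t m x u)"
    have "occ t m x v" unfolding v_def using \<open>occ t m x u\<close> by (rule LeastI)
    have "occ s m x v \<and> (\<forall>u<v. \<not> occ s m x u)" if "t \<le> s" for s
      using that
    proof (induction s rule: dec_induct)
      case base
      then show ?case using \<open>occ t m x v\<close> not_less_Least v_def by blast
    next
      case (step s)
      \<comment> \<open>The entry respects some witness, and by the induction hypothesis no witness
        is smaller than \<open>v\<close>.\<close>
      have "v \<le> pfst s" if "E s"
        using T[of s v] that step \<open>T \<le> t\<close> by (meson le_trans not_less)
      then show ?case using occ_Suc[of s m x v] step.IH by auto
    qed
    moreover obtain s where "t \<le> s" "occ s m x v \<longleftrightarrow> Q K m x v"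
      using eventually_agree[of v] unfolding eventually_sequentially by (meson le_refl nat_le_linear)
    ultimately show False using False by blast
  qed
  then show ?thesis using False unfolding eventually_sequentially settled_def by blast
qed

lemma priority_settled:
  assumes "\<forall>\<^sub>F t in sequentially. E t \<longrightarrow> m < level t \<or> m = level t \<and> x \<le> Suc (target t)"
  shows "\<forall>\<^sub>F t in sequentially. settled t m x"
proof (rule respected_settled)
  show "\<forall>\<^sub>F t in sequentially. E t \<longrightarrow> (\<forall>u. occ t m x u \<longrightarrow> (\<exists>u'\<le>pfst t. occ t m x u'))"
    using assms
  proof eventually_elim
    case (elim t)
    show ?case
    proof (intro impI allI)
      fix u assume "E t" and u: "occ t m x u"
      then have "observes Q A (G t) t (level t) (Suc (target t)) (bound t)" using enters_def by blast
      moreover have "x \<le> t" using u Q_le occurs_le unfolding occurs_def by (meson le_trans)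
      moreover have "u \<le> t" using u by (rule occurs_le)
      ultimately obtain u' where "u' \<le> bound t" "occ t m x u'"
        using elim \<open>E t\<close> u unfolding observes_def by (metis le_eq_less_or_eq)
      moreover have "bound t \<le> pfst t"
        using pair_pair_le(2)[of "bound t" "level t" "target t"] by simp
      ultimately show "\<exists>u'\<le>pfst t. occ t m x u'" by (meson le_trans)
    qed
  qed
qed

definition true_observes :: "nat \<Rightarrow> nat \<Rightarrow> nat \<Rightarrow> bool" where
  "true_observes m x y \<longleftrightarrow> (\<forall>m'\<le>m. \<forall>x'. m' < m \<or> x' \<le> x \<longrightarrow>
     (\<forall>u. Q K m' x' u \<longrightarrow> (\<exists>u'\<le>y. Q K m' x' u')))"

lemma observes_iff:
  assumes "\<And>m' x'. m' < m \<or> m' = m \<and> x' \<le> x \<Longrightarrow> settled t m' x'"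
  shows "observes Q A (G t) t m x y \<longleftrightarrow> true_observes m x y"
proof -
  have bd: "x' \<le> t \<and> u \<le> t" if "occ t m' x' u" for m' x' u
    using that Q_le occurs_le unfolding occurs_def by (meson le_trans)
  have "observes Q A (G t) t m x y \<longleftrightarrow> (\<forall>m' x'. m' < m \<or> m' = m \<and> x' \<le> x \<longrightarrow>
      (\<exists>u. occ t m' x' u) \<longrightarrow> (\<exists>u\<le>y. occ t m' x' u))"
  proof (intro iffI allI impI)
    fix m' x' assume o: "observes Q A (G t) t m x y" and "m' < m \<or> m' = m \<and> x' \<le> x"
      and "\<exists>u. occ t m' x' u"
    then obtain u where "occ t m' x' u" "m' \<le> m" "m' < m \<or> x' \<le> x" by auto
    then show "\<exists>u\<le>y. occ t m' x' u" using o bd unfolding observes_def by blast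
  next
    assume *: "\<forall>m' x'. m' < m \<or> m' = m \<and> x' \<le> x \<longrightarrow> (\<exists>u. occ t m' x' u) \<longrightarrow> (\<exists>u\<le>y. occ t m' x' u)"
    show "observes Q A (G t) t m x y" unfolding observes_def
    proof (intro allI impI)
      fix m' x' u assume "m' \<le> m" "m' < m \<or> x' \<le> x" "occ t m' x' u"
      then show "\<exists>u'\<le>y. occ t m' x' u'" using *[rule_format, of m' x'] by (cases "m' = m") auto
    qed
  qed
  also have "\<dots> \<longleftrightarrow> (\<forall>m' x'. m' < m \<or> m' = m \<and> x' \<le> x \<longrightarrow>
      (\<exists>u. Q K m' x' u) \<longrightarrow> (\<exists>u\<le>y. Q K m' x' u))"
  proof (rule iff_allI, rule iff_allI, rule imp_cong[OF refl])
    fix m' x' assume "m' < m \<or> m' = m \<and> x' \<le> x"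
    then have "settled t m' x'" by (rule assms)
    then show "((\<exists>u. occ t m' x' u) \<longrightarrow> (\<exists>u\<le>y. occ t m' x' u)) \<longleftrightarrow>
        ((\<exists>u. Q K m' x' u) \<longrightarrow> (\<exists>u\<le>y. Q K m' x' u))"
      unfolding settled_def by blast
  qed
  also have "\<dots> \<longleftrightarrow> true_observes m x y"
    unfolding true_observes_def by (metis le_eq_less_or_eq)
  finally show ?thesis .
qed

text \<open>
  Event \<open>0\<close> of a level does not count here: it is the computation to be preserved.
\<close>

definition fails :: "nat \<Rightarrow> bool" where
  "fails m \<longleftrightarrow> (\<exists>x. \<forall>u. \<not> Q K m (Suc x) u)"

definition done_below :: "nat \<Rightarrow> bool" where
  "done_below m \<longleftrightarrow>
     (\<forall>\<^sub>F t in sequentially. (E t \<longrightarrow> m \<le> level t) \<and> (\<forall>m'<m. \<forall>x. settled t m' x))"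

text \<open>Candidates of level \<open>m\<close> have at best the priority of event 1, so event 0
  outranks all candidates of level \<open>m\<close> and beyond.\<close>

lemma done_below_0_settled:
  assumes "done_below m" shows "\<forall>\<^sub>F t in sequentially. settled t m 0"
  using assms unfolding done_below_def
  by (intro priority_settled) (auto elim: eventually_mono)

text \<open>Let \<open>Suc a\<close> be the first event after event 0 that never happens. The events
  up to \<open>a\<close> settle, so a target below \<open>a\<close> is eventually left with a single
  bound and only finitely many numbers enter for such targets. Event \<open>Suc a\<close> then
  outranks all remaining entries and settles as absent. All later events of the level disappear with
  it, and so do the remaining candidates.\<close>

lemma done_below_Suc:
  assumes "done_below m" "fails m" shows "done_below (Suc m)"
proof -
  define a where "a = (LEAST x. \<forall>u. \<not> Q K m (Suc x) u)"
  have a: "\<not> Q K m (Suc a) u" for u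
    using LeastI_ex[OF assms(2)[unfolded fails_def]] a_def by blast
  have lt: "\<exists>u. Q K m (Suc x) u" if "x < a" for x
    using not_less_Least[of x "\<lambda>x. \<forall>u. \<not> Q K m (Suc x) u"] that a_def by blast
  have "\<forall>\<^sub>F t in sequentially. settled t m x" if "x \<le> a" for x
  proof (cases x)
    case 0
    then show ?thesis using done_below_0_settled assms(1) by simp
  next
    case (Suc x')
    then obtain u where "Q K m x u" using lt[of x'] \<open>x \<le> a\<close> by auto
    then show ?thesis by (rule true_settled)
  qed
  then have small: "\<forall>\<^sub>F t in sequentially. \<forall>x\<le>a. settled t m x"
    using eventually_ball_finite[of "{..a}" "\<lambda>t x. settled t m x" sequentially] by (auto simp: Ball_def)
  \<comment> \<open>The only possible candidates for targets below \<open>a\<close> once the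
    relevant restraints have settled.\<close>
  define F where "F = (\<lambda>x. pair m (pair x (LEAST y. true_observes m (Suc x) y))) ` {..<a}"
  have "finite F" by (simp add: F_def)
  have ge: "\<forall>\<^sub>F t in sequentially. E t \<longrightarrow> level t = m \<longrightarrow> a \<le> target t"
    using assms(1)[unfolded done_below_def] small finitely_often[OF \<open>finite F\<close>, of Q A]
  proof eventually_elim
    case (elim t)
    show ?case
    proof (intro impI, rule ccontr)
      assume E: "E t" and m: "level t = m" and "\<not> a \<le> target t"
      then have lt: "target t < a" by simp
      have iff: "observes Q A (G t) t m (Suc (target t)) y \<longleftrightarrow> true_observes m (Suc (target t)) y" for y
        using elim(1,2) lt by (intro observes_iff) auto
      have "(LEAST y. true_observes m (Suc (target t)) y) = bound t"
        using E m unfolding enters_def iff[symmetric]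
        by (intro Least_equality) (auto simp: not_less[symmetric])
      then have "pfst t = pair m (pair (target t) (LEAST y. true_observes m (Suc (target t)) y))"
        using m by (metis prod_decode_pfst_psnd)
      then have "pfst t \<in> F" unfolding F_def using lt by blast
      then show False using elim(3) E by blast
    qed
  qed
  have "\<forall>\<^sub>F t in sequentially. settled t m (Suc a)"
  proof (rule priority_settled)
    show "\<forall>\<^sub>F t in sequentially. E t \<longrightarrow> m < level t \<or> m = level t \<and> Suc a \<le> Suc (target t)"
      using assms(1)[unfolded done_below_def] ge by eventually_elim auto
  qed
  then show ?thesis
    unfolding done_below_def using assms(1)[unfolded done_below_def] small ge
  proof eventually_elim
    case (elim t)
    have none: "\<not> occ t m (Suc x) u" if "a \<le> x" for x u
      using that settledD[OF elim(1)] a occ_antimono by blast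
    have noQ: "\<not> Q K m (Suc x) u" if "a \<le> x" for x u
      using that a Q_antimono by blast
    have "level t \<noteq> m" if "E t"
      using that elim(4) none[of "target t"] unfolding enters_def by blast
    moreover have "settled t m x" for x
    proof (cases "x \<le> a")
      case False
      then obtain x' where "x = Suc x'" "a \<le> x'" by (cases x) auto
      then show ?thesis using none noQ unfolding settled_def by blast
    qed (use elim in blast)
    ultimately show ?case using elim(2) by (auto simp: less_Suc_eq Suc_le_eq le_neq_implies_less)
  qed
qed

lemma done_below: "(\<And>m'. m' < m \<Longrightarrow> fails m') \<Longrightarrow> done_below m"
proof (induction m)
  case 0
  then show ?case by (simp add: done_below_def)
qed (simp add: done_below_Suc)

text \<open>Every level is eventually reached, so event 0 of each level settles. In the application
  this event is a computation from \<open>K\<close>, and the approximation is recursive in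
  \<open>A\<close>.\<close>

lemma all_fail_limit:
  assumes "\<And>m. fails m"
  shows "\<forall>\<^sub>F t in sequentially. (\<exists>u\<le>t. occ t m 0 u) \<longleftrightarrow> (\<exists>u. Q K m 0 u)"
  using done_below_0_settled[OF done_below[OF assms], of m]
proof eventually_elim
  case (elim t)
  then show ?case using settledD occurs_le by metis
qed

text \<open>On the first level that does not fail, the restraints of lower levels and of event 0 are
  finite in number and bounded by \<open>b\<close>, while all later events happen. So the final
  bound for \<open>x\<close> is the least number beyond \<open>b\<close> and beyond a witness of
  event \<open>Suc x\<close>, and the candidate with this bound enters iff \<open>x\<close> is in
  the jump of \<open>A\<close>.\<close>

lemma some_succeeds_coding:
  assumes "\<not> fails m" "\<And>m'. m' < m \<Longrightarrow> fails m'"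
  obtains b where "\<forall>x. \<exists>y. b \<le> y \<and> (\<exists>u\<le>y. Q K m (Suc x) u)"
    "\<forall>x. x \<in> jump A \<longleftrightarrow> pair m (pair x (LEAST y. b \<le> y \<and> (\<exists>u\<le>y. Q K m (Suc x) u))) \<in> entered Q A"
proof -
  define c where "c y \<longleftrightarrow> (\<forall>m'\<le>m. \<forall>x'. m' < m \<or> x' = 0 \<longrightarrow>
     (\<exists>u. Q K m' x' u) \<longrightarrow> (\<exists>u'\<le>y. Q K m' x' u'))" for y
  \<comment> \<open>As the lower levels fail, only finitely many of their events happen, so
    \<open>S\<close> is finite.\<close>
  define S where "S = {(m', x'). m' \<le> m \<and> (m' < m \<or> x' = 0) \<and> (\<exists>u. Q K m' x' u)}"
  obtain X where X: "\<And>m' u. m' < m \<Longrightarrow> \<not> Q K m' (Suc (X m')) u"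
    using assms(2) unfolding fails_def by metis
  have "S \<subseteq> (SIGMA m':{..m}. insert 0 {..X m'})"
  proof
    fix p assume "p \<in> S"
    moreover obtain m' x' where "p = (m', x')" by fastforce
    moreover have "x' \<le> X m'" if "m' < m" "Q K m' x' u" for u
    proof (rule ccontr)
      assume "\<not> x' \<le> X m'"
      then obtain x where "x' = Suc x" "X m' \<le> x" by (cases x') auto
      then show False using X that Q_antimono by blast
    qed
    ultimately show "p \<in> (SIGMA m':{..m}. insert 0 {..X m'})" unfolding S_def by auto
  qed
  then have "finite S" by (rule finite_subset) auto
  then have fin: "finite ((\<lambda>(m', x'). LEAST u. Q K m' x' u) ` S)" by (rule finite_imageI)
  have "c (Max ((\<lambda>(m', x'). LEAST u. Q K m' x' u) ` S))" unfolding c_def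
  proof (intro allI impI)
    fix m' x' assume *: "m' \<le> m" "m' < m \<or> x' = 0" "\<exists>u. Q K m' x' u"
    then have "(LEAST u. Q K m' x' u) \<in> (\<lambda>(m', x'). LEAST u. Q K m' x' u) ` S"
      by (force simp: S_def)
    then show "\<exists>u'\<le>Max ((\<lambda>(m', x'). LEAST u. Q K m' x' u) ` S). Q K m' x' u'"
      using Max_ge[OF fin] LeastI_ex[OF *(3)] by blast
  qed
  then have cb: "c (Least c)" by (rule LeastI)
  \<comment> \<open>The predicate \<open>c\<close> is upward closed, hence given by a threshold;
    \<open>Least c\<close> serves as \<open>b\<close>.\<close>
  have c: "c y \<longleftrightarrow> Least c \<le> y" for y
  proof
    show "Least c \<le> y" if "c y" using that by (rule Least_le)
    show "c y" if "Least c \<le> y" unfolding c_def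
    proof (intro allI impI)
      fix m' x' assume "m' \<le> m" "m' < m \<or> x' = 0" "\<exists>u. Q K m' x' u"
      then obtain u where "u \<le> Least c" "Q K m' x' u" using cb unfolding c_def by blast
      then show "\<exists>u'\<le>y. Q K m' x' u'" using that le_trans by blast
    qed
  qed
  have ex: "\<exists>u. Q K m (Suc x) u" for x using assms(1) fails_def by blast
  have iff: "true_observes m (Suc x) y \<longleftrightarrow> Least c \<le> y \<and> (\<exists>u\<le>y. Q K m (Suc x) u)" for x y
  proof
    assume tr: "true_observes m (Suc x) y"
    then have "c y" unfolding true_observes_def c_def by auto
    moreover have "\<exists>u\<le>y. Q K m (Suc x) u" using tr ex unfolding true_observes_def by blast
    ultimately show "Least c \<le> y \<and> (\<exists>u\<le>y. Q K m (Suc x) u)" using c by blast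
  next
    assume "Least c \<le> y \<and> (\<exists>u\<le>y. Q K m (Suc x) u)"
    then obtain u where cy: "c y" and u: "u \<le> y" "Q K m (Suc x) u" using c by blast
    show "true_observes m (Suc x) y" unfolding true_observes_def
    proof (intro allI impI)
      fix m' x' v assume *: "m' \<le> m" "m' < m \<or> x' \<le> Suc x" "Q K m' x' v"
      show "\<exists>u'\<le>y. Q K m' x' u'"
      proof (cases "m' < m \<or> x' = 0")
        case True
        then show ?thesis using cy * unfolding c_def by blast
      next
        case False
        \<comment> \<open>A witness of event \<open>Suc x\<close> also witnesses the events 1 to
          \<open>Suc x\<close> of the same level.\<close>
        then obtain x'' where "x' = Suc x''" "x'' \<le> x" "m' = m" using * by (cases x') auto
        then show ?thesis using u Q_antimono by blast
      qed
    qed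
  qed
  have dn: "done_below m" using assms(2) by (rule done_below)
  have "x \<in> jump A \<longleftrightarrow> pair m (pair x (LEAST y. true_observes m (Suc x) y)) \<in> entered Q A"
    (is "_ \<longleftrightarrow> ?i \<in> _") for x
  proof
    assume "?i \<in> entered Q A"
    then obtain t where "?i = pfst t" "E t" unfolding entered_def by blast
    then show "x \<in> jump A" unfolding jump_iff enters_def by (metis fst_conv prod_encode_inverse snd_conv)
  next
    assume "x \<in> jump A"
    then obtain d where d: "halts A x x d" using jump_iff by blast
    have "\<forall>\<^sub>F t in sequentially. settled t m x'" for x'
    proof (cases x')
      case 0
      then show ?thesis using done_below_0_settled[OF dn] by simp
    next
      case (Suc x'')
      then show ?thesis using ex[of x''] true_settled by blast
    qed
    then have "\<forall>\<^sub>F t in sequentially. \<forall>x'\<le>Suc x. settled t m x'"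
      using eventually_ball_finite[of "{..Suc x}" "\<lambda>t x. settled t m x" sequentially] by (auto simp: Ball_def)
    then have "\<forall>\<^sub>F t in sequentially. d < t \<and> (\<exists>u\<le>t. occ t m (Suc x) u) \<and>
        (\<forall>y. observes Q A (G t) t m (Suc x) y \<longleftrightarrow> true_observes m (Suc x) y)"
      using eventually_gt_at_top[of d] dn[unfolded done_below_def]
    proof eventually_elim
      case (elim t)
      have "\<exists>u\<le>t. occ t m (Suc x) u" using elim(1) settledD ex occurs_le by (meson le_refl)
      moreover have "observes Q A (G t) t m (Suc x) y \<longleftrightarrow> true_observes m (Suc x) y" for y
        using elim(1,3) by (intro observes_iff) auto
      ultimately show ?case using elim(2) by blast
    qed
    then obtain T where T: "\<And>t. t \<ge> T \<Longrightarrow> d < t \<and> (\<exists>u\<le>t. occ t m (Suc x) u) \<and>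
        (\<forall>y. observes Q A (G t) t m (Suc x) y \<longleftrightarrow> true_observes m (Suc x) y)"
      unfolding eventually_sequentially by blast
    \<comment> \<open>The candidate is considered at stages \<open>pair ?i T\<close> with
      \<open>T\<close> arbitrarily large.\<close>
    define t where "t = pair ?i T"
    have "T \<le> t" unfolding t_def by (rule le_prod_encode_2)
    note T = T[OF this]
    have t: "level t = m" "target t = x" "bound t = (LEAST y. true_observes m (Suc x) y)" "pfst t = ?i"
      by (simp_all add: t_def)
    have tr: "\<exists>y. true_observes m (Suc x) y" using iff ex by (meson le_trans linear)
    show "?i \<in> entered Q A"
    proof (cases "\<exists>s<t. pair ?i s \<in> G t")
      case True
      then show ?thesis by (auto simp: entries_iff entered_def)
    next
      case False
      have "E t" unfolding enters_def t(1-3)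
      proof (intro conjI)
        show "\<forall>s<t. pair (pfst t) s \<notin> G t" using False t by simp
        show "\<exists>c<t. halts A x x c" using T d by blast
        show "\<exists>u\<le>t. occ t m (Suc x) u" using T by blast
        show "observes Q A (G t) t m (Suc x) (LEAST y. true_observes m (Suc x) y)"
          using T LeastI_ex[OF tr] by blast
        show "\<forall>y<(LEAST y. true_observes m (Suc x) y). \<not> observes Q A (G t) t m (Suc x) y"
          using T not_less_Least by blast
      qed
      then show ?thesis unfolding entered_def using t(4) by force
    qed
  qed
  then have "x \<in> jump A \<longleftrightarrow>
      pair m (pair x (LEAST y. Least c \<le> y \<and> (\<exists>u\<le>y. Q K m (Suc x) u))) \<in> entered Q A" for x
    unfolding iff .
  moreover have "\<exists>y. Least c \<le> y \<and> (\<exists>u\<le>y. Q K m (Suc x) u)" for x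
    using ex by (meson linear le_refl le_trans)
  ultimately show ?thesis using that by blast
qed

end

section \<open>The outer construction\<close>

text \<open>
  The marker exceeds the stages at which numbers up to \<open>n\<close> entered \<open>B\<close>, so coding \<open>n\<close> can
  only injure the entries of numbers greater than \<open>n\<close>.
\<close>

primrec stage :: "event \<Rightarrow> nat \<Rightarrow> nat set" where
  "stage Q 0 = {}"
| "stage Q (Suc s) = (if \<exists>c<s. halts {} (pfst s) (pfst s) c
     then insert (pair (pfst s) (marker (entries Q (stage Q s) s) (pfst s))) (stage Q s) else stage Q s)"

definition built :: "event \<Rightarrow> nat set" where
  "built Q = (\<Union>s. stage Q s)"

lemma finite_stage [simp]: "finite (stage Q s)"
  by (induction s) auto

lemma stage_mono: "s \<le> s' \<Longrightarrow> stage Q s \<subseteq> stage Q s'"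
proof (induction s' rule: dec_induct)
  case (step s')
  then show ?case by auto
qed simp

lemma stage_subset_built: "stage Q s \<subseteq> built Q"
  unfolding built_def by blast

lemma pfst_stage: "a \<in> stage Q s \<Longrightarrow> pfst a \<in> jump {}"
  by (induction s) (auto simp: jump_iff split: if_splits)

lemma eventually_stage_agrees:
  assumes "finite F" shows "\<forall>\<^sub>F s in sequentially. \<forall>a\<in>F. a \<in> stage Q s \<longleftrightarrow> a \<in> built Q"
proof -
  have "\<forall>\<^sub>F s in sequentially. a \<in> stage Q s \<longleftrightarrow> a \<in> built Q" for a
  proof (cases "a \<in> built Q")
    case False
    then have "a \<notin> stage Q s" for s using stage_subset_built by blast
    with False show ?thesis by simp
  next
    case True
    then obtain s where "a \<in> stage Q s" unfolding built_def by blast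
    then have "\<forall>s'\<ge>s. a \<in> stage Q s'" using stage_mono by blast
    then show ?thesis using True unfolding eventually_sequentially by blast
  qed
  then show ?thesis
    using eventually_ball_finite[OF assms, of "\<lambda>s a. a \<in> stage Q s \<longleftrightarrow> a \<in> built Q"] by simp
qed

lemma eventually_stage_Int: "\<forall>\<^sub>F s in sequentially. stage Q s \<inter> {..<t} = built Q \<inter> {..<t}"
  using eventually_stage_agrees[of "{..<t}" Q] by (auto elim: eventually_mono)

definition limit_entries :: "event \<Rightarrow> nat set" where
  "limit_entries Q = (\<Union>t. entries Q (built Q) t)"

lemma limit_entries_iff:
  "e \<in> limit_entries Q \<longleftrightarrow> (\<exists>s. e = pair (pfst s) s \<and> entering Q (built Q) s)"
  unfolding limit_entries_def by (auto simp: mem_entries)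

lemma entries_functional:
  assumes "pair i s \<in> entries Q A t" "pair i s' \<in> entries Q A t'"
  shows "s = s'"
  using assms unfolding entries_iff by (metis entering_unique)

text \<open>Finite injury, by induction on \<open>i\<close>. Once the entries of smaller numbers are
  final, numbers below \<open>i\<close> are no longer coded. Suppose \<open>i\<close> is then
  present with entry stage \<open>r\<close>. Any later coding concerns a number that is at least
  \<open>i\<close>, whose marker exceeds \<open>r\<close>, so \<open>A\<close> below
  \<open>Suc r\<close> never changes again and by locality the entry is permanent. If
  \<open>i\<close> is never present at such stages, it does not enter in the limit either, since an
  entry depends on a finite part of \<open>A\<close>.\<close>

lemma eventually_entries_agree:
  "\<forall>\<^sub>F s in sequentially. \<forall>e. pfst e < i \<longrightarrow> (e \<in> entries Q (stage Q s) s \<longleftrightarrow> e \<in> limit_entries Q)"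
proof (induction i)
  case 0
  then show ?case by simp
next
  case (Suc i)
  let ?G = "\<lambda>s. entries Q (stage Q s) s"
  let ?mk = "marker (limit_entries Q)"
  have "\<forall>\<^sub>F s in sequentially. \<forall>a\<in>(\<lambda>n. pair n (?mk n)) ` {..<i}. a \<in> stage Q s \<longleftrightarrow> a \<in> built Q"
    by (rule eventually_stage_agrees) simp
  with Suc have "\<forall>\<^sub>F s in sequentially. (\<forall>e. pfst e < i \<longrightarrow> (e \<in> ?G s \<longleftrightarrow> e \<in> limit_entries Q)) \<and>
      (pfst s < i \<longrightarrow> stage Q (Suc s) = stage Q s)"
  proof eventually_elim
    case (elim s)
    \<comment> \<open>The current location is already the final one, and final locations in
      \<open>built Q\<close> are already present, so nothing new is added.\<close>
    have "stage Q (Suc s) = stage Q s" if lt: "pfst s < i"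
    proof -
      have "marker (?G s) (pfst s) = ?mk (pfst s)"
        using elim(1) lt by (intro marker_cong) auto
      then have "pair (pfst s) (marker (?G s) (pfst s)) \<in> (\<lambda>n. pair n (?mk n)) ` {..<i}"
        using lt by auto
      then show ?thesis using elim(2) stage_subset_built[of Q "Suc s"] by (auto split: if_splits)
    qed
    then show ?case using elim(1) by blast
  qed
  then obtain S where S: "\<And>s e. s \<ge> S \<Longrightarrow> pfst e < i \<Longrightarrow> e \<in> ?G s \<longleftrightarrow> e \<in> limit_entries Q"
    "\<And>s. s \<ge> S \<Longrightarrow> pfst s < i \<Longrightarrow> stage Q (Suc s) = stage Q s"
    unfolding eventually_sequentially by blast
  have "\<exists>S'\<ge>S. \<forall>s\<ge>S'. \<forall>r. pair i r \<in> ?G s \<longleftrightarrow> pair i r \<in> limit_entries Q"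
  proof (cases "\<exists>s r. s \<ge> S \<and> pair i r \<in> ?G s")
    case True
    then obtain s r where s: "s \<ge> S" "pair i r \<in> ?G s" by blast
    then have "r < s" by (simp add: entries_iff)
    have r0: "pair i r \<in> entries Q (stage Q s) (Suc r)" using s(2) by (simp add: entries_iff)
    have keep: "stage Q s' \<inter> {..<Suc r} = stage Q s \<inter> {..<Suc r}" if "s \<le> s'" for s'
      using that
    proof (induction s' rule: dec_induct)
      case (step s')
      have "pair i r \<in> entries Q (stage Q s') (Suc r)"
        using r0 entries_local[OF step.IH] by simp
      then have r: "pair i r \<in> ?G s'"
        using entries_mono[of "Suc r" s'] \<open>r < s\<close> step.hyps by auto
      show ?case
      proof (cases "pfst s' < i")
        case True
        then show ?thesis using S(2)[of s'] step s(1) by simp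
      next
        case False
        then have "r < marker (?G s') (pfst s')" using marker_greater[OF _ r, of "pfst s'"] by simp
        then have "pair (pfst s') (marker (?G s') (pfst s')) \<notin> {..<Suc r}"
          using le_prod_encode_2[of "marker (?G s') (pfst s')" "pfst s'"] by auto
        then show ?thesis using step.IH by auto
      qed
    qed simp
    have in_G: "pair i r \<in> ?G s'" if "s \<le> s'" for s'
    proof -
      have "pair i r \<in> entries Q (stage Q s') (Suc r)" using r0 entries_local[OF keep[OF that]] by simp
      then show ?thesis using entries_mono[of "Suc r" s'] \<open>r < s\<close> that by auto
    qed
    have "built Q \<inter> {..<Suc r} = stage Q s \<inter> {..<Suc r}"
    proof -
      obtain s' where s': "s \<le> s'" "stage Q s' \<inter> {..<Suc r} = built Q \<inter> {..<Suc r}"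
        using eventually_conj[OF eventually_ge_at_top[of s] eventually_stage_Int[of Q "Suc r"]]
        unfolding eventually_sequentially by blast
      show ?thesis using s'(2)[symmetric] keep[OF s'(1)] by (rule trans)
    qed
    then have lim: "pair i r \<in> limit_entries Q"
      using r0 entries_local[of "built Q" "Suc r" "stage Q s" Q] unfolding limit_entries_def by blast
    have "pair i r' \<in> ?G s' \<longleftrightarrow> pair i r' \<in> limit_entries Q" if "s \<le> s'" for s' r'
    proof
      assume "pair i r' \<in> ?G s'"
      then have "r' = r" using in_G[OF that] by (rule entries_functional)
      then show "pair i r' \<in> limit_entries Q" using lim by simp
    next
      assume "pair i r' \<in> limit_entries Q"
      then obtain t' where "pair i r' \<in> entries Q (built Q) t'" unfolding limit_entries_def by blast
      moreover obtain t where "pair i r \<in> entries Q (built Q) t" using lim unfolding limit_entries_def by blast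
      ultimately have "r' = r" by (rule entries_functional)
      then show "pair i r' \<in> ?G s'" using in_G[OF that] by simp
    qed
    then show ?thesis using s(1) by blast
  next
    case False
    have "pair i r \<notin> limit_entries Q" for r
    proof
      assume "pair i r \<in> limit_entries Q"
      then obtain t where t: "pair i r \<in> entries Q (built Q) t" unfolding limit_entries_def by blast
      obtain s0 where "\<And>s. s \<ge> s0 \<Longrightarrow> stage Q s \<inter> {..<t} = built Q \<inter> {..<t}"
        using eventually_stage_Int[of Q t] unfolding eventually_sequentially by blast
      then have "entries Q (stage Q (max s0 (max t S))) t = entries Q (built Q) t"
        by (intro entries_local) simp
      then have "pair i r \<in> entries Q (stage Q (max s0 (max t S))) t" using t by simp
      moreover have "t \<le> max s0 (max t S)" by simp
      ultimately have "pair i r \<in> ?G (max s0 (max t S))" using entries_mono by blast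
      moreover have "S \<le> max s0 (max t S)" by simp
      ultimately show False using False by blast
    qed
    then show ?thesis using False by blast
  qed
  then obtain S' where S': "S' \<ge> S" "\<And>s r. s \<ge> S' \<Longrightarrow> pair i r \<in> ?G s \<longleftrightarrow> pair i r \<in> limit_entries Q"
    by blast
  have "e \<in> ?G s \<longleftrightarrow> e \<in> limit_entries Q" if "s \<ge> S'" "pfst e < Suc i" for s e
  proof (cases "pfst e = i")
    case True
    then have "e = pair i (psnd e)" using prod_decode_pfst_psnd[of e] by simp
    then show ?thesis using S'(2)[OF that(1), of "psnd e"] by metis
  next
    case False
    then show ?thesis using S(1) S'(1) that by simp
  qed
  then show ?case unfolding eventually_sequentially by blast
qed

text \<open>Each \<open>n\<close> in the halting set is treated at a stage so late that its marker
  is final, and only elements of the halting set are ever coded. Along the true \<open>A\<close> the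
  marker becomes constant because numbers up to \<open>n\<close> enter only finitely often.\<close>

lemma built_coding:
  "\<forall>\<^sub>F t in sequentially. n \<in> jump {} \<longleftrightarrow> pair n (marker (entries Q (built Q) t) n) \<in> built Q"
proof -
  have K: "n \<in> jump {} \<longleftrightarrow> pair n (marker (limit_entries Q) n) \<in> built Q"
  proof
    assume "n \<in> jump {}"
    then obtain c where c: "halts {} n n c" using jump_iff by blast
    obtain S where S: "\<And>s e. s \<ge> S \<Longrightarrow> pfst e < Suc n \<Longrightarrow> e \<in> entries Q (stage Q s) s \<longleftrightarrow> e \<in> limit_entries Q"
      using eventually_entries_agree[of "Suc n" Q] unfolding eventually_sequentially by blast
    define s where "s = pair n (S + Suc c)"
    have s: "S + Suc c \<le> s" "pfst s = n" unfolding s_def using le_prod_encode_2 by auto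
    have "marker (entries Q (stage Q s) s) n = marker (limit_entries Q) n"
      using S s(1) by (intro marker_cong) simp
    moreover have "\<exists>c<s. halts {} n n c" using c s(1) by (intro exI[of _ c]) simp
    ultimately have "pair n (marker (limit_entries Q) n) \<in> stage Q (Suc s)"
      using s(2) by simp
    then show "pair n (marker (limit_entries Q) n) \<in> built Q" using stage_subset_built by blast
  next
    assume "pair n (marker (limit_entries Q) n) \<in> built Q"
    then show "n \<in> jump {}" unfolding built_def using pfst_stage by fastforce
  qed
  have "\<forall>\<^sub>F t in sequentially. marker (entries Q (built Q) t) n = marker (limit_entries Q) n"
  proof -
    obtain T where T: "\<And>t. t \<ge> T \<Longrightarrow> entering Q (built Q) t \<Longrightarrow> pfst t \<notin> {..n}"
      using finitely_often[of "{..n}" Q "built Q"] unfolding eventually_sequentially by auto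
    have "marker (entries Q (built Q) t) n = marker (limit_entries Q) n" if "T \<le> t" for t
    proof (rule marker_cong)
      fix e assume e: "pfst e \<le> n"
      show "e \<in> entries Q (built Q) t \<longleftrightarrow> e \<in> limit_entries Q"
        unfolding mem_entries limit_entries_iff
      proof
        assume "\<exists>s. e = pair (pfst s) s \<and> entering Q (built Q) s"
        then obtain s where s: "e = pair (pfst s) s" "entering Q (built Q) s" by blast
        have "pfst s \<in> {..n}" using e s(1) by simp
        then have "s < t" using T[of s] s(2) that by (meson le_trans not_less)
        then show "\<exists>s<t. e = pair (pfst s) s \<and> entering Q (built Q) s" using s by blast
      qed blast
    qed
    then show ?thesis unfolding eventually_sequentially by blast
  qed
  then show ?thesis by eventually_elim (simp add: K)
qed

text \<open>Stagewise entries converge on each number; this is what makes \<open>B\<close> recursive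
  in the halting set.\<close>

lemma entered_limit:
  "\<forall>\<^sub>F s in sequentially. (\<exists>r<s. pair i r \<in> entries Q (stage Q s) s) \<longleftrightarrow> i \<in> entered Q (built Q)"
  using eventually_entries_agree[of "Suc i" Q]
proof eventually_elim
  case (elim s)
  have "(\<exists>r<s. pair i r \<in> entries Q (stage Q s) s) \<longleftrightarrow> (\<exists>r. pair i r \<in> entries Q (stage Q s) s)"
    by (auto simp: entries_iff)
  also have "\<dots> \<longleftrightarrow> (\<exists>r. pair i r \<in> limit_entries Q)" using elim by simp
  also have "\<dots> \<longleftrightarrow> i \<in> entered Q (built Q)"
    unfolding entered_def limit_entries_iff by (auto intro: exI)
  finally show ?case .
qed

section \<open>Effectiveness of the construction\<close>

lemma recursive_comp7:
  assumes "recursive_in A (\<lambda>p. f (pfst p) (pfst (psnd p)) (pfst (psnd (psnd p)))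
      (pfst (psnd (psnd (psnd p)))) (pfst (psnd (psnd (psnd (psnd p)))))
      (pfst (psnd (psnd (psnd (psnd (psnd p)))))) (psnd (psnd (psnd (psnd (psnd (psnd p)))))))"
    "recursive_in A g" "recursive_in A h" "recursive_in A k" "recursive_in A l" "recursive_in A m"
    "recursive_in A n" "recursive_in A j"
  shows "recursive_in A (\<lambda>x. f (g x) (h x) (k x) (l x) (m x) (n x) (j x))"
  using recursive_comp[OF assms(1) recursive_pair[OF assms(2) recursive_pair[OF assms(3)
        recursive_pair[OF assms(4) recursive_pair[OF assms(5) recursive_pair[OF assms(6)
        recursive_pair[OF assms(7,8)]]]]]]] by simp

text \<open>Event 0 of level \<open>m\<close> is the computation of program \<open>m\<close> on
  input \<open>m\<close> that is to be preserved. Event \<open>x > 0\<close> refutes every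
  \<open>k < x\<close> as a witness for \<open>\<exists>k. \<forall>l. h(z,m,k,l) \<in> X\<close>.
  The bounds by \<open>u\<close> make it depend on \<open>X\<close> below \<open>u\<close> only, and
  \<open>x \<le> u\<close> provides \<open>Q_le\<close>.\<close>

definition requirement :: "(nat \<Rightarrow> nat) \<Rightarrow> nat \<Rightarrow> event" where
  "requirement h z X m x u \<longleftrightarrow> (if x = 0 then halts X m m u else x \<le> u \<and>
     (\<forall>k<x. \<exists>l<u. h (pair (pair (pair z m) k) l) < u \<and> h (pair (pair (pair z m) k) l) \<notin> X))"

lemma requirement_local:
  assumes "X \<inter> {..<u} = Y \<inter> {..<u}"
  shows "requirement h z X m x u \<longleftrightarrow> requirement h z Y m x u"
proof -
  have "\<And>a. a < u \<Longrightarrow> a \<in> X \<longleftrightarrow> a \<in> Y" using assms by blast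
  then show ?thesis unfolding requirement_def halts_local[OF assms] by meson
qed

lemma requirement_le: "requirement h z X m x u \<Longrightarrow> x \<le> u"
  by (auto simp: requirement_def split: if_splits)

lemma requirement_Suc: "requirement h z X m (Suc (Suc x)) u \<Longrightarrow> requirement h z X m (Suc x) u"
  by (auto simp: requirement_def)

interpretation construction: inner_construction "requirement h z" "built (requirement h z)" "jump {}" for h z
  by unfold_locales (erule requirement_local requirement_le requirement_Suc | rule built_coding)+

lemma fails_iff: "construction.fails h z m \<longleftrightarrow> (\<exists>k. \<forall>l. h (pair (pair (pair z m) k) l) \<in> jump {})"
proof
  assume "construction.fails h z m"
  then obtain x where x: "\<And>u. \<not> requirement h z (jump {}) m (Suc x) u"
    unfolding construction.fails_def by blast
  show "\<exists>k. \<forall>l. h (pair (pair (pair z m) k) l) \<in> jump {}"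
  proof (rule ccontr)
    assume "\<not> ?thesis"
    then obtain l where l: "\<And>k. h (pair (pair (pair z m) k) (l k)) \<notin> jump {}" by metis
    \<comment> \<open>Exceeds all counterexamples \<open>l k\<close> and the corresponding values of
      \<open>h\<close>, for \<open>k\<close> up to \<open>x\<close>.\<close>
    define u where "u = Suc x + (\<Sum>k<Suc x. Suc (l k) + Suc (h (pair (pair (pair z m) k) (l k))))"
    have "Suc (l k) + Suc (h (pair (pair (pair z m) k) (l k))) \<le> u" if "k < Suc x" for k
      using member_le_sum[of k "{..<Suc x}" "\<lambda>k. Suc (l k) + Suc (h (pair (pair (pair z m) k) (l k)))"] that
      unfolding u_def by simp
    then have "\<forall>k<Suc x. l k < u \<and> h (pair (pair (pair z m) k) (l k)) < u" by force
    moreover have "Suc x \<le> u" unfolding u_def by simp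
    ultimately have "requirement h z (jump {}) m (Suc x) u"
      unfolding requirement_def using l by auto
    then show False using x by blast
  qed
next
  assume "\<exists>k. \<forall>l. h (pair (pair (pair z m) k) l) \<in> jump {}"
  then obtain k where k: "\<And>l. h (pair (pair (pair z m) k) l) \<in> jump {}" by blast
  have "\<not> requirement h z (jump {}) m (Suc k) u" for u
    using k unfolding requirement_def by auto
  then show "construction.fails h z m" unfolding construction.fails_def by blast
qed

section \<open>Computability of the construction, uniformly in \<open>z\<close>\<close>

lemma recursive_marker [recI]:
  assumes "recursive_in A k" "recursive_in A n"
  shows "recursive_in A (\<lambda>x. marker (set_decode (k x)) (n x))"
proof -
  have eq: "marker (set_decode k) n = (LEAST g. \<forall>e<k. e \<in> set_decode k \<longrightarrow> pfst e \<le> n \<longrightarrow> psnd e < g)" for k n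
    unfolding marker_def by (rule arg_cong[of _ _ Least]) (use mem_set_decode_less in blast)
  have ex: "\<exists>g. \<forall>e<k. e \<in> set_decode k \<longrightarrow> pfst e \<le> n \<longrightarrow> psnd e < g" for k n
    using le_prod_encode_2 by (metis le_less_trans prod_decode_pfst_psnd)
  have "recursive_in A (\<lambda>p. marker (set_decode (pfst p)) (psnd p))"
    unfolding eq by (intro recI ex)
  from recursive_comp2[OF this assms] show ?thesis .
qed

lemma decidable_trusted [recI]:
  assumes "recursive_in A k" "recursive_in A t" "recursive_in A u"
  shows "decidable_in A (\<lambda>x. trusted (set_decode (k x)) (t x) (u x))"
proof -
  have "decidable_in A (\<lambda>p. trusted (set_decode (pfst p)) (pfst (psnd p)) (psnd (psnd p)))"
    unfolding trusted_def by (intro recI)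
  from recursive_comp3[OF this assms] show ?thesis .
qed

context
  fixes A h assumes h: "recursive_in A h"
begin

lemma decidable_requirement:
  assumes "recursive_in A z" "recursive_in A k" "recursive_in A m" "recursive_in A x" "recursive_in A u"
  shows "decidable_in A (\<lambda>w. requirement h (z w) (set_decode (k w)) (m w) (x w) (u w))"
proof -
  have "decidable_in A (\<lambda>p. requirement h (pfst p) (set_decode (pfst (psnd p))) (pfst (psnd (psnd p)))
      (pfst (psnd (psnd (psnd p)))) (psnd (psnd (psnd (psnd p)))))"
    unfolding requirement_def by (intro recI recursive_comp[OF h])
  from recursive_comp5[OF this assms] show ?thesis .
qed

lemma decidable_occurs:
  assumes "recursive_in A z" "recursive_in A a" "recursive_in A k" "recursive_in A t"
    "recursive_in A m" "recursive_in A x" "recursive_in A u"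
  shows "decidable_in A (\<lambda>w. occurs (requirement h (z w)) (set_decode (a w)) (set_decode (k w)) (t w)
      (m w) (x w) (u w))"
proof -
  \<comment> \<open>Presents the current approximation to \<open>K\<close> as a coded finite set,
    the form handled by \<open>decidable_requirement\<close>.\<close>
  have eq: "{n. n < (u::nat) \<and> P n} = set_decode (set_encode {n. n < u \<and> P n})" for P u by simp
  have "decidable_in A (\<lambda>p. occurs (requirement h (pfst p)) (set_decode (pfst (psnd p)))
      (set_decode (pfst (psnd (psnd p)))) (pfst (psnd (psnd (psnd p))))
      (pfst (psnd (psnd (psnd (psnd p))))) (pfst (psnd (psnd (psnd (psnd (psnd p))))))
      (psnd (psnd (psnd (psnd (psnd (psnd p)))))))"
    unfolding occurs_def by (subst eq) (intro recI decidable_requirement)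
  from recursive_comp7[OF this assms] show ?thesis .
qed

lemma decidable_observes:
  assumes "recursive_in A z" "recursive_in A a" "recursive_in A k" "recursive_in A t"
    "recursive_in A m" "recursive_in A x" "recursive_in A y"
  shows "decidable_in A (\<lambda>w. observes (requirement h (z w)) (set_decode (a w)) (set_decode (k w)) (t w)
      (m w) (x w) (y w))"
proof -
  have "decidable_in A (\<lambda>p. observes (requirement h (pfst p)) (set_decode (pfst (psnd p)))
      (set_decode (pfst (psnd (psnd p)))) (pfst (psnd (psnd (psnd p))))
      (pfst (psnd (psnd (psnd (psnd p))))) (pfst (psnd (psnd (psnd (psnd (psnd p))))))
      (psnd (psnd (psnd (psnd (psnd (psnd p)))))))"
    unfolding observes_def by (intro recI decidable_occurs)
  from recursive_comp7[OF this assms] show ?thesis .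
qed

lemma decidable_enters:
  assumes "recursive_in A z" "recursive_in A a" "recursive_in A k" "recursive_in A t"
  shows "decidable_in A (\<lambda>w. enters (requirement h (z w)) (set_decode (a w)) (set_decode (k w)) (t w))"
proof -
  have "decidable_in A (\<lambda>p. enters (requirement h (pfst p)) (set_decode (pfst (psnd p)))
      (set_decode (pfst (psnd (psnd p)))) (psnd (psnd (psnd p))))"
    unfolding enters_def by (intro recI decidable_occurs decidable_observes)
  from recursive_comp4[OF this assms] show ?thesis .
qed

lemma recursive_entries:
  assumes "recursive_in A z" "recursive_in A a" "recursive_in A t"
  shows "recursive_in A (\<lambda>w. set_encode (entries (requirement h (z w)) (set_decode (a w)) (t w)))"
proof -
  \<comment> \<open>An entry carries its stage, so the inserted pair is always new and its code is
    updated by adding a power of 2.\<close>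
  have new: "pair (pfst t) t \<notin> entries Q X t" for Q X t by (simp add: entries_iff)
  have "set_encode (entries (requirement h z) (set_decode a) t) = rec_nat 0 (\<lambda>t k.
      if enters (requirement h z) (set_decode a) (set_decode k) t then 2 ^ pair (pfst t) t + k else k) t" for z a t
  proof (induction t)
    case (Suc t)
    show ?case unfolding old.nat.simps(7) Suc.IH[symmetric] by (simp add: new)
  qed simp
  then have "recursive_in A (\<lambda>p. set_encode (entries (requirement h (pfst p)) (set_decode (pfst (psnd p))) (psnd (psnd p))))"
    by (simp only:) (intro recI decidable_enters)
  from recursive_comp3[OF this assms] show ?thesis .
qed

lemma recursive_stage:
  assumes "recursive_in A z" "recursive_in A s"
  shows "recursive_in A (\<lambda>w. set_encode (stage (requirement h (z w)) (s w)))"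
proof -
  define g where "g z a s = pair (pfst s) (marker (set_decode (set_encode
      (entries (requirement h z) (set_decode a) s))) (pfst s))" for z a s
  have g: "g z (set_encode (stage (requirement h z) s)) s =
      pair (pfst s) (marker (entries (requirement h z) (stage (requirement h z) s) s) (pfst s))" for z s
    by (simp add: g_def)
  \<comment> \<open>A coding location may be present already, in which case the code must stay
    unchanged.\<close>
  have "set_encode (stage (requirement h z) s) = rec_nat 0 (\<lambda>s a.
      if (\<exists>c<s. halts (set_decode 0) (pfst s) (pfst s) c) \<and> g z a s \<notin> set_decode a
      then 2 ^ g z a s + a else a) s" for z s
  proof (induction s)
    case (Suc s)
    show ?case unfolding old.nat.simps(7) Suc.IH[symmetric] g by (auto simp: insert_absorb)
  qed simp
  then have "recursive_in A (\<lambda>p. set_encode (stage (requirement h (pfst p)) (psnd p)))"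
    by (simp only: g_def) (intro recI recursive_entries)
  from recursive_comp2[OF this assms] show ?thesis .
qed

end

text \<open>Event 0 of level \<open>e\<close> is true of the halting set iff \<open>e\<close> is in
  its jump. The approximation at stage \<open>t\<close> needs \<open>A\<close> only below
  \<open>t\<close> and converges for every \<open>e\<close>, so the limit lemma applies relative to
  \<open>A\<close>.\<close>

lemma high_built:
  assumes "recursive h" "\<And>m. construction.fails h z m"
  shows "high (built (requirement h z))"
proof -
  let ?Q = "requirement h z" let ?A = "built (requirement h z)"
  have h: "recursive_in ?A h" using assms(1) by (rule recursive_recursive_in)
  define tr where "tr t = set_encode {n. n < t \<and> n \<in> ?A}" for t
  have tr: "set_decode (tr t) \<inter> {..<t} = ?A \<inter> {..<t}" for t by (auto simp: tr_def)
  have "recursive_in ?A tr" unfolding tr_def by (intro recI recursive_oracle)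
  note rtr = recursive_comp[OF this]
  have "decidable_in ?A (\<lambda>p. \<exists>u\<le>psnd p. occurs ?Q (set_decode (tr (psnd p)))
      (set_decode (set_encode (entries ?Q (set_decode (tr (psnd p))) (psnd p)))) (psnd p) (pfst p) 0 u)"
    by (intro recI decidable_occurs[OF h] recursive_entries[OF h] rtr)
  then have "decidable_in ?A (\<lambda>p. \<exists>u\<le>psnd p. occurs ?Q ?A (entries ?Q ?A (psnd p)) (psnd p) (pfst p) 0 u)"
    unfolding occurs_local[OF tr] entries_local[OF tr] by simp
  moreover have "\<exists>s. \<forall>t\<ge>s. (\<exists>u\<le>psnd (pair e t). occurs ?Q ?A (entries ?Q ?A (psnd (pair e t)))
      (psnd (pair e t)) (pfst (pair e t)) 0 u) \<longleftrightarrow> e \<in> jump (jump {})" for e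
    using construction.all_fail_limit[of h z e, OF assms(2)]
    by (simp add: eventually_sequentially jump_iff requirement_def)
  ultimately show ?thesis unfolding high_def by (rule limit_lemma)
qed

lemma entered_le_jump:
  assumes "recursive h" shows "Turing_le (entered (requirement h z) (built (requirement h z))) (jump {})"
proof (rule limit_lemma)
  let ?Q = "requirement h z"
  show "decidable_in {} (\<lambda>p. \<exists>r<psnd p. pair (pfst p) r \<in> set_decode (set_encode
      (entries ?Q (set_decode (set_encode (stage ?Q (psnd p)))) (psnd p))))"
    by (intro recI recursive_entries[OF assms] recursive_stage[OF assms])
  show "\<exists>s. \<forall>t\<ge>s. (\<exists>r<psnd (pair i t). pair (pfst (pair i t)) r \<in> set_decode (set_encode
      (entries ?Q (set_decode (set_encode (stage ?Q (psnd (pair i t))))) (psnd (pair i t))))) \<longleftrightarrow>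
      i \<in> entered ?Q (built ?Q)" for i
    using entered_limit[of i ?Q] by (simp add: eventually_sequentially)
qed

text \<open>On the least level that does not fail, the final candidate for \<open>x\<close> is found
  recursively in the halting set \<open>K\<close>, and so is its membership in \<open>B\<close>;
  hence the jump of \<open>A\<close> is recursive in \<open>K\<close>. Were \<open>A\<close> high,
  the jump of \<open>K\<close> would be recursive in \<open>K\<close>.\<close>

lemma low_built:
  assumes "recursive h" "\<not> construction.fails h z m"
  shows "\<not> high (built (requirement h z))"
proof
  let ?Q = "requirement h z" let ?A = "built (requirement h z)" let ?K = "jump {}"
  assume "high ?A"
  define m where "m = (LEAST m. \<not> construction.fails h z m)"
  have m: "\<not> construction.fails h z m" "\<And>m'. m' < m \<Longrightarrow> construction.fails h z m'"
    using LeastI[of "\<lambda>m. \<not> construction.fails h z m", OF assms(2)]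
      not_less_Least[of _ "\<lambda>m. \<not> construction.fails h z m"] unfolding m_def by blast+
  obtain b where "\<forall>x. \<exists>y. b \<le> y \<and> (\<exists>u\<le>y. ?Q ?K m (Suc x) u)"
    "\<forall>x. x \<in> jump ?A \<longleftrightarrow> pair m (pair x (LEAST y. b \<le> y \<and> (\<exists>u\<le>y. ?Q ?K m (Suc x) u))) \<in> entered ?Q ?A"
    by (rule construction.some_succeeds_coding[OF m])
  note b = this[rule_format]
  have h: "recursive_in ?K h" using assms(1) by (rule recursive_recursive_in)
  have ent: "recursive_in ?K (\<lambda>x. of_bool (x \<in> entered ?Q ?A))"
    using entered_le_jump[OF assms(1)] unfolding Turing_le_def .
  have req: "?Q ?K m (Suc x) u \<longleftrightarrow> Suc x \<le> u \<and> (\<forall>k<Suc x. \<exists>l<u. h (pair (pair (pair z m) k) l) < u \<and>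
      h (pair (pair (pair z m) k) l) \<notin> ?K)" for x u
    by (simp add: requirement_def)
  have "decidable_in ?K (\<lambda>x. pair m (pair x (LEAST y. b \<le> y \<and> (\<exists>u\<le>y. ?Q ?K m (Suc x) u))) \<in> entered ?Q ?A)"
    by (rule recursive_comp[OF ent], use b(1) in \<open>unfold req\<close>)
      (intro recI recursive_oracle recursive_comp[OF h], assumption)
  then have "Turing_le (jump ?A) ?K" unfolding Turing_le_def b(2) .
  then have "Turing_le (jump ?K) ?K" using \<open>high ?A\<close> Turing_le_trans unfolding high_def by blast
  then show False using jump_not_le by blast
qed

theorem high_built_iff:
  assumes "recursive h"
  shows "high (built (requirement h z)) \<longleftrightarrow>
    (\<forall>m. \<exists>k. \<forall>l. h (pair (pair (pair z m) k) l) \<in> jump {})"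
  using high_built[OF assms] low_built[OF assms] unfolding fails_iff by blast

section \<open>The arithmetical hierarchy\<close>

lemma Sigma_set_preimage:
  "Sigma_set n A \<Longrightarrow> recursive f \<Longrightarrow> Sigma_set n {x. f x \<in> A}"
proof (induction n arbitrary: A f)
  case 0
  then show ?case using recursive_comp[of "{}" "\<lambda>x. of_bool (x \<in> A)" f] by simp
next
  case (Suc n)
  then obtain B where B: "Sigma_set n B" "A = {x. \<exists>y. pair x y \<in> - B}" by auto
  have "recursive (\<lambda>w. pair (f (pfst w)) (psnd w))"
    by (intro recI recursive_comp[OF Suc.prems(2)])
  then have "Sigma_set n {w. pair (f (pfst w)) (psnd w) \<in> B}" using Suc.IH[OF B(1)] by simp
  then show ?case unfolding B(2) Sigma_set.simps by (intro exI conjI) auto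
qed

text \<open>The two closure properties need a joint induction, since passing to complements
  exchanges them from level to level.\<close>

lemma Sigma_set_Un_Int:
  "Sigma_set n A \<Longrightarrow> Sigma_set n B \<Longrightarrow> Sigma_set n (A \<union> B) \<and> Sigma_set n (A \<inter> B)"
proof (induction n arbitrary: A B)
  case 0
  show ?case
    using decidable_disj[OF 0[unfolded Sigma_set.simps]] decidable_conj[OF 0[unfolded Sigma_set.simps]] by simp
next
  case (Suc n)
  obtain C where C: "Sigma_set n C" "A = {x. \<exists>y. pair x y \<in> - C}" using Suc.prems(1) by auto
  obtain D where D: "Sigma_set n D" "B = {x. \<exists>y. pair x y \<in> - D}" using Suc.prems(2) by auto
  have un: "A \<union> B = {x. \<exists>y. pair x y \<in> - (C \<inter> D)}" unfolding C(2) D(2) by auto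
  have "Sigma_set n {w. pair (pfst w) (pfst (psnd w)) \<in> C}"
    by (rule Sigma_set_preimage[OF C(1)]) (intro recI)
  moreover have "Sigma_set n {w. pair (pfst w) (psnd (psnd w)) \<in> D}"
    by (rule Sigma_set_preimage[OF D(1)]) (intro recI)
  ultimately have "Sigma_set n ({w. pair (pfst w) (pfst (psnd w)) \<in> C} \<union> {w. pair (pfst w) (psnd (psnd w)) \<in> D})"
    using Suc.IH by blast
  moreover have "A \<inter> B = {x. \<exists>y. pair x y \<in> - ({w. pair (pfst w) (pfst (psnd w)) \<in> C} \<union>
      {w. pair (pfst w) (psnd (psnd w)) \<in> D})}" (is "_ = ?r")
  proof (intro equalityI subsetI)
    fix x assume "x \<in> A \<inter> B"
    then obtain y y' where "pair x y \<notin> C" "pair x y' \<notin> D" unfolding C(2) D(2) by auto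
    then show "x \<in> ?r" by (auto intro!: exI[of _ "pair y y'"])
  qed (auto simp: C(2) D(2))
  ultimately show ?case using un Suc.IH[OF C(1) D(1)] unfolding Sigma_set.simps by blast
qed

lemma Sigma_set_Ex:
  assumes "Sigma_set (Suc n) A" shows "Sigma_set (Suc n) {x. \<exists>y. pair x y \<in> A}"
proof -
  obtain B where B: "Sigma_set n B" "A = {x. \<exists>y. pair x y \<in> - B}" using assms by auto
  have "Sigma_set n {v. pair (pair (pfst v) (pfst (psnd v))) (psnd (psnd v)) \<in> B}"
    by (rule Sigma_set_preimage[OF B(1)]) (intro recI)
  moreover have "{x. \<exists>y. pair x y \<in> A} =
      {x. \<exists>v. pair x v \<in> - {v. pair (pair (pfst v) (pfst (psnd v))) (psnd (psnd v)) \<in> B}}"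
    unfolding B(2) by (auto intro: exI[of _ "pair _ _"])
  ultimately show ?thesis unfolding Sigma_set.simps by blast
qed

lemma Sigma_set_SucI:
  "Sigma_set n B \<Longrightarrow> (\<And>x. x \<in> A \<longleftrightarrow> (\<exists>y. pair x y \<notin> B)) \<Longrightarrow> Sigma_set (Suc n) A"
  unfolding Sigma_set.simps by blast

lemma Sigma_set_4I:
  assumes "decidable_in {} R"
  shows "Sigma_set 4 {x. \<exists>p. \<forall>n. \<exists>w. \<forall>d. R (pair (pair (pair (pair x p) n) w) d)}"
proof -
  have 0: "Sigma_set 0 {x. R x}" using assms by simp
  have 1: "Sigma_set (Suc 0) {v. \<exists>d. \<not> R (pair v d)}"
    by (rule Sigma_set_SucI[OF 0]) simp
  have 2: "Sigma_set (Suc (Suc 0)) {v. \<exists>w. \<forall>d. R (pair (pair v w) d)}"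
    by (rule Sigma_set_SucI[OF 1]) simp
  have 3: "Sigma_set (Suc (Suc (Suc 0))) {v. \<exists>n. \<forall>w. \<exists>d. \<not> R (pair (pair (pair v n) w) d)}"
    by (rule Sigma_set_SucI[OF 2]) simp
  have eq: "4 = Suc (Suc (Suc (Suc 0)))" by simp
  show ?thesis unfolding eq by (rule Sigma_set_SucI[OF 3]) simp
qed

lemma re_in_Sigma_set_1: "Sigma_set (Suc 0) A \<Longrightarrow> re_in {} A"
proof -
  assume "Sigma_set (Suc 0) A"
  then obtain B where B: "decidable_in {} (\<lambda>x. x \<in> B)" "A = {x. \<exists>y. pair x y \<in> - B}" by auto
  show "re_in {} A"
    by (rule re_inI[of _ "\<lambda>x. x \<notin> B"]) (use B in \<open>auto intro: recI\<close>)
qed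

text \<open>The base case is the enumeration theorem with coded computations as decidable matrix;
  complementation and projection keep the index and preserve universality.\<close>

lemma universal_Sigma_set:
  "\<exists>U. Sigma_set (Suc n) U \<and> (\<forall>A. Sigma_set (Suc n) A \<longrightarrow> (\<exists>e. A = {x. pair e x \<in> U}))"
proof (induction n)
  case 0
  define B where "B = {v. \<not> halts (set_decode 0) (pfst (pfst v)) (psnd (pfst v)) (psnd v)}"
  define U where "U = {x. \<exists>y. pair x y \<in> - B}"
  have "Sigma_set 0 B" unfolding B_def by (simp only: Sigma_set.simps mem_Collect_eq) (intro recI)
  then have "Sigma_set (Suc 0) U" unfolding U_def Sigma_set.simps(2) by blast
  moreover have "\<exists>e. A = {x. pair e x \<in> U}" if A: "Sigma_set (Suc 0) A" for A
  proof -
    obtain p where p: "\<And>x. run {} p x \<noteq> None \<longleftrightarrow> x \<in> A"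
      using re_in_dom[OF re_in_Sigma_set_1[OF A]] by blast
    have "A = {x. pair (goedel p) x \<in> U}"
      unfolding U_def B_def using p run_eq_None_iff[of "{}" p] by auto
    then show ?thesis ..
  qed
  ultimately show ?case by blast
next
  case (Suc n)
  then obtain U where U: "Sigma_set (Suc n) U"
    "\<And>A. Sigma_set (Suc n) A \<Longrightarrow> \<exists>e. A = {x. pair e x \<in> U}" by blast
  define V where "V = {w. \<exists>y. pair w y \<in> - {v. pair (pfst (pfst v)) (pair (psnd (pfst v)) (psnd v)) \<in> U}}"
  have "Sigma_set (Suc n) {v. pair (pfst (pfst v)) (pair (psnd (pfst v)) (psnd v)) \<in> U}"
    by (rule Sigma_set_preimage[OF U(1)]) (intro recI)
  then have "Sigma_set (Suc (Suc n)) V" unfolding V_def Sigma_set.simps(2)[of "Suc n"] by blast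
  moreover have "\<exists>e. A = {x. pair e x \<in> V}" if A: "Sigma_set (Suc (Suc n)) A" for A
  proof -
    obtain B where B: "Sigma_set (Suc n) B" "A = {x. \<exists>y. pair x y \<in> - B}"
      using A unfolding Sigma_set.simps(2)[of "Suc n"] by blast
    obtain e where "B = {x. pair e x \<in> U}" using U(2)[OF B(1)] by blast
    then have "A = {x. pair e x \<in> V}" unfolding B(2) V_def by simp
    then show ?thesis ..
  qed
  ultimately show ?case by blast
qed

lemma Sigma_set_hierarchy: "\<exists>D. Sigma_set (Suc n) D \<and> \<not> Sigma_set (Suc n) (- D)"
proof -
  obtain U where U: "Sigma_set (Suc n) U"
    "\<And>A. Sigma_set (Suc n) A \<Longrightarrow> \<exists>e. A = {x. pair e x \<in> U}" using universal_Sigma_set by blast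
  have "Sigma_set (Suc n) {x. pair x x \<in> U}" by (rule Sigma_set_preimage[OF U(1)]) (intro recI)
  moreover have "\<not> Sigma_set (Suc n) (- {x. pair x x \<in> U})"
  proof
    assume "Sigma_set (Suc n) (- {x. pair x x \<in> U})"
    then obtain e where "- {x. pair x x \<in> U} = {x. pair e x \<in> U}" using U(2) by blast
    then show False by blast
  qed
  ultimately show ?thesis by blast
qed

section \<open>Uniformly r.e. families and their index sets\<close>

definition re_family :: "(nat \<Rightarrow> nat set) \<Rightarrow> bool" where
  "re_family W \<longleftrightarrow> re_in {} {w. psnd w \<in> W (pfst w)}"

lemma re_familyI:
  assumes "decidable_in {} R" "\<And>i x. x \<in> W i \<longleftrightarrow> (\<exists>s. R (pair (pair i x) s))"
  shows "re_family W"
  unfolding re_family_def by (rule re_inI[OF assms(1)]) (simp add: assms(2))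

lemma re_familyE:
  assumes "re_family W"
  obtains R where "decidable_in {} R" "\<And>i x. x \<in> W i \<longleftrightarrow> (\<exists>s. R (pair (pair i x) s))"
proof -
  obtain R where R: "decidable_in {} R" "{w. psnd w \<in> W (pfst w)} = {x. \<exists>y. R (pair x y)}"
    using assms unfolding re_family_def re_in_def by blast
  have "x \<in> W i \<longleftrightarrow> (\<exists>s. R (pair (pair i x) s))" for i x
    using set_eq_iff[THEN iffD1, OF R(2), THEN spec[of _ "pair i x"]] by simp
  then show ?thesis using R(1) that by blast
qed

lemma re_family_re_set:
  assumes "re_family W" shows "re_set (W i)"
proof -
  obtain R where R: "decidable_in {} R" "\<And>i x. x \<in> W i \<longleftrightarrow> (\<exists>s. R (pair (pair i x) s))"
    using re_familyE[OF assms] by blast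
  have "decidable_in {} (\<lambda>w. R (pair (pair i (pfst w)) (psnd w)))"
    by (intro recI recursive_comp[OF R(1)])
  then show ?thesis by (intro re_set_re_in re_inI) (auto simp: R(2))
qed

text \<open>The complement of a suitable \<open>\<Sigma>\<^sub>4\<close> set \<open>D\<close>
  unfolds to \<open>\<forall>m. \<exists>k. \<forall>l\<close> in front of an r.e. condition, which
  \<open>h\<close> reduces to the halting set. The construction for this \<open>h\<close> makes
  \<open>- D\<close> the set of indices of high members.\<close>

theorem high_index_not_Sigma_4:
  obtains W where "re_family W" "\<not> Sigma_set 4 {z. high (W z)}"
proof -
  obtain D where D: "Sigma_set 4 D" "\<not> Sigma_set 4 (- D)"
    using Sigma_set_hierarchy[of 3] by (auto simp del: Sigma_set.simps simp: eval_nat_numeral)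
  obtain B3 where B3: "Sigma_set 3 B3" "D = {x. \<exists>y. pair x y \<in> - B3}"
    using D(1) Sigma_set.simps(2)[of 3 D] by auto
  obtain B2 where B2: "Sigma_set 2 B2" "B3 = {x. \<exists>y. pair x y \<in> - B2}"
    using B3(1) Sigma_set.simps(2)[of 2 B3] by auto
  obtain B1 where B1: "Sigma_set (Suc 0) B1" "B2 = {x. \<exists>y. pair x y \<in> - B1}"
    using B2(1) Sigma_set.simps(2)[of "Suc 0" B2] by (auto simp del: Sigma_set.simps simp: numeral_2_eq_2)
  obtain h where h: "recursive h" "\<And>x. x \<in> B1 \<longleftrightarrow> h x \<in> jump {}"
    using re_in_many_one[OF re_in_Sigma_set_1[OF B1(1)]] by metis
  have "- D = {z. high (built (requirement h z))}"
    unfolding high_built_iff[OF h(1)] B3(2) B2(2) B1(2) h(2)[symmetric] by auto blast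
  moreover have "re_family (\<lambda>z. built (requirement h z))"
  proof (rule re_familyI)
    show "decidable_in {} (\<lambda>w. psnd (pfst w) \<in> set_decode (set_encode (stage (requirement h (pfst (pfst w))) (psnd w))))"
      by (intro recI recursive_stage[OF h(1)])
  qed (simp add: built_def)
  ultimately show ?thesis using D(2) that by metis
qed

lemma eventually_approx:
  assumes "\<And>x. x \<in> S \<longleftrightarrow> (\<exists>s. R x s)"
  shows "\<forall>\<^sub>F t in sequentially. {x. x < c \<and> (\<exists>r<t. R x r)} = S \<inter> {..<(c::nat)}"
proof -
  have "\<forall>\<^sub>F t in sequentially. (\<exists>r<t. R x r) \<longleftrightarrow> x \<in> S" for x
  proof (cases "x \<in> S")
    case True
    then obtain r where "R x r" using assms by blast
    from eventually_gt_at_top[of r] show ?thesis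
      by eventually_elim (use \<open>R x r\<close> True in blast)
  qed (use assms in auto)
  then have "\<forall>\<^sub>F t in sequentially. \<forall>x\<in>{..<c}. (\<exists>r<t. R x r) \<longleftrightarrow> x \<in> S"
    by (intro eventually_ball_finite) auto
  then show ?thesis by eventually_elim auto
qed

text \<open>Reducibility means \<open>\<exists>p. \<forall>n. \<exists>c\<close> with
  \<open>c\<close> a correct computation. Correctness involves finite parts of the r.e. sets and is
  the limit of a decidable approximation, so it can be written as
  \<open>\<exists>s. \<forall>t\<ge>s\<close>. Merging \<open>c\<close> and \<open>s\<close> into
  \<open>w\<close> leaves four alternating quantifiers.\<close>

lemma Sigma_set_Turing_le:
  assumes "re_family W" "re_family L"
  shows "Sigma_set 4 {v. Turing_le (W (pfst v)) (L (psnd v))}"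
proof -
  obtain R where R: "decidable_in {} R" "\<And>i x. x \<in> W i \<longleftrightarrow> (\<exists>s. R (pair (pair i x) s))"
    using re_familyE[OF assms(1)] by blast
  obtain T where T: "decidable_in {} T" "\<And>i x. x \<in> L i \<longleftrightarrow> (\<exists>s. T (pair (pair i x) s))"
    using re_familyE[OF assms(2)] by blast
  define C where "C z i p n c t \<longleftrightarrow> computes (set_decode (set_encode {x. x < c \<and> (\<exists>r<t. T (pair (pair i x) r))}))
      p n (of_bool (\<exists>r<t. R (pair (pair z n) r))) c" for z i p n c t
  have ev: "\<forall>\<^sub>F t in sequentially. C z i p n c t \<longleftrightarrow> computes (L i) p n (of_bool (n \<in> W z)) c" for z i p n c
    using eventually_approx[OF R(2), of "Suc n" z] eventually_approx[OF T(2), of c i]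
  proof eventually_elim
    case (elim t)
    have "(\<exists>r<t. R (pair (pair z n) r)) \<longleftrightarrow> n \<in> W z"
      using set_eq_iff[THEN iffD1, OF elim(1), THEN spec[of _ n]] by simp
    moreover have "computes (L i \<inter> {..<c}) p n y c \<longleftrightarrow> computes (L i) p n y c" for y
      by (rule computes_local) auto
    ultimately show ?case unfolding C_def elim(2) by simp
  qed
  have "Turing_le (W z) (L i) \<longleftrightarrow> (\<exists>p. \<forall>n. \<exists>w. \<forall>d. C z i p n (pfst w) (psnd w + d))" for z i
  proof -
    have "Turing_le (W z) (L i) \<longleftrightarrow> (\<exists>f. \<forall>n. run (L i) f n = Some (of_bool (n \<in> W z)))"
      unfolding Turing_le_def recursive_in_def partial_recursive_in_def by (simp add: fun_eq_iff)
    also have "\<dots> \<longleftrightarrow> (\<exists>p. \<forall>n. \<exists>c. computes (L i) p n (of_bool (n \<in> W z)) c)"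
      unfolding run_eq_Some_iff using surj_goedel by metis
    also have "\<dots> \<longleftrightarrow> (\<exists>p. \<forall>n. \<exists>w. \<forall>d. C z i p n (pfst w) (psnd w + d))"
    proof (rule iff_exI, rule iff_allI, rule iffI)
      fix p n assume "\<exists>c. computes (L i) p n (of_bool (n \<in> W z)) c"
      then obtain c s where "\<And>t. t \<ge> s \<Longrightarrow> C z i p n c t"
        using ev unfolding eventually_sequentially by blast
      then show "\<exists>w. \<forall>d. C z i p n (pfst w) (psnd w + d)" by (intro exI[of _ "pair c s"]) simp
    next
      fix p n assume "\<exists>w. \<forall>d. C z i p n (pfst w) (psnd w + d)"
      then obtain c s where s: "\<And>d. C z i p n c (s + d)" by blast
      obtain t where "\<And>t'. t' \<ge> t \<Longrightarrow> C z i p n c t' \<longleftrightarrow> computes (L i) p n (of_bool (n \<in> W z)) c"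
        using ev unfolding eventually_sequentially by blast
      from this[of "s + t"] s[of t] show "\<exists>c. computes (L i) p n (of_bool (n \<in> W z)) c" by auto
    qed
    finally show ?thesis .
  qed
  then have eq: "{v. Turing_le (W (pfst v)) (L (psnd v))} =
      {v. \<exists>p. \<forall>n. \<exists>w. \<forall>d. C (pfst v) (psnd v) p n (pfst w) (psnd w + d)}" by simp
  define Z where "Z x \<longleftrightarrow> C (pfst (pfst (pfst (pfst (pfst x))))) (psnd (pfst (pfst (pfst (pfst x)))))
      (psnd (pfst (pfst (pfst x)))) (psnd (pfst (pfst x))) (pfst (psnd (pfst x))) (psnd (psnd (pfst x)) + psnd x)" for x
  have "decidable_in {} Z" unfolding Z_def C_def
    by (intro recI recursive_comp[OF R(1)] recursive_comp[OF T(1)])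
  from Sigma_set_4I[OF this] show ?thesis unfolding eq by (simp add: Z_def)
qed

lemma Turing_equiv_high: "Turing_equiv A B \<Longrightarrow> high B \<Longrightarrow> high A"
  unfolding Turing_equiv_def high_def using jump_mono Turing_le_trans by blast

text \<open>Highness is invariant under Turing equivalence, so a member of any r.e. family would be
  high iff it is equivalent to \<open>L i\<close> for some \<open>i\<close> in \<open>I\<close>.
  That is a \<open>\<Sigma>\<^sub>4\<close> condition, contrary to
  \<open>high_index_not_Sigma_4\<close>.\<close>

theorem high_family_not_Sigma_4:
  assumes "re_family L" "Sigma_set 4 I" "\<And>i. i \<in> I \<Longrightarrow> high (L i)"
    and "\<And>W. re_set W \<Longrightarrow> high W \<Longrightarrow> \<exists>i\<in>I. Turing_equiv W (L i)"
  shows False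
proof -
  obtain W where W: "re_family W" "\<not> Sigma_set 4 {z. high (W z)}" by (rule high_index_not_Sigma_4)
  have 1: "Sigma_set 4 {v. Turing_le (W (pfst v)) (L (psnd v))}"
    using Sigma_set_Turing_le[OF W(1) assms(1)] .
  have 2: "Sigma_set 4 {v. pair (psnd v) (pfst v) \<in> {v. Turing_le (L (pfst v)) (W (psnd v))}}"
    by (rule Sigma_set_preimage[OF Sigma_set_Turing_le[OF assms(1) W(1)]]) (intro recI)
  have 3: "Sigma_set 4 {v. psnd v \<in> I}" by (rule Sigma_set_preimage[OF assms(2)]) (intro recI)
  have "Sigma_set (Suc 3) ({v. psnd v \<in> I} \<inter> ({v. Turing_le (W (pfst v)) (L (psnd v))} \<inter>
      {v. pair (psnd v) (pfst v) \<in> {v. Turing_le (L (pfst v)) (W (psnd v))}}))"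
    using 1 2 3 Sigma_set_Un_Int[of 4] by (simp del: Sigma_set.simps)
  from Sigma_set_Ex[OF this] have "Sigma_set 4 {z. \<exists>i. i \<in> I \<and> Turing_equiv (W z) (L i)}"
    unfolding Turing_equiv_def by (simp del: Sigma_set.simps)
  moreover have "high (W z) \<longleftrightarrow> (\<exists>i. i \<in> I \<and> Turing_equiv (W z) (L i))" for z
    using assms(3,4) Turing_equiv_high re_family_re_set[OF W(1)] by blast
  ultimately show False using W(2) by simp
qed

section \<open>Left-r.e. reals and their left cuts\<close>

definition dyadic :: "nat \<Rightarrow> real" where
  "dyadic w = real (pfst w) / 2 ^ psnd w"

text \<open>For left-r.e. reals the cuts are r.e. uniformly in an index, whereas the binary
  expansion need not be r.e.\<close>

definition left_cut :: "real \<Rightarrow> nat set" where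
  "left_cut r = {w. dyadic w < r}"

lemma dyadic_pair [simp]: "dyadic (pair k n) = real k / 2 ^ n"
  by (simp add: dyadic_def)

lemma dyadic_nonneg: "0 \<le> dyadic w"
  by (simp add: dyadic_def)

lemma dyadic_less_iff: "dyadic v < dyadic w \<longleftrightarrow> pfst v * 2 ^ psnd w < pfst w * 2 ^ psnd v"
proof -
  have "dyadic v < dyadic w \<longleftrightarrow> real (pfst v * 2 ^ psnd w) < real (pfst w * 2 ^ psnd v)"
    by (simp add: dyadic_def divide_less_eq less_divide_eq mult.commute field_simps)
  then show ?thesis by (simp only: of_nat_less_iff)
qed

lemma dyadic_dense:
  assumes "0 \<le> a" "a < b" shows "\<exists>w. a < dyadic w \<and> dyadic w < b"
proof -
  obtain n where n: "(1 / 2) ^ n < b - a"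
    using real_arch_pow_inv[of "b - a" "1 / 2"] assms by auto
  define k where "k = Suc (nat \<lfloor>2 ^ n * a\<rfloor>)"
  have k: "2 ^ n * a < real k" "real k \<le> 2 ^ n * a + 1"
  proof -
    have "real k = real_of_int \<lfloor>2 ^ n * a\<rfloor> + 1" using assms(1) by (simp add: k_def)
    then show "2 ^ n * a < real k" "real k \<le> 2 ^ n * a + 1"
      using real_of_int_floor_add_one_gt[of "2 ^ n * a"] of_int_floor_le[of "2 ^ n * a"] by linarith+
  qed
  have "1 < 2 ^ n * (b - a)" using n by (simp add: field_simps)
  then have "2 ^ n * a < real k" "real k < 2 ^ n * b" using k by (auto simp: algebra_simps)
  then have "a < dyadic (pair k n)" "dyadic (pair k n) < b" by (simp_all add: field_simps)
  then show ?thesis by blast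
qed

lemma left_cut_inject:
  assumes "0 \<le> r" "0 \<le> s" "left_cut r = left_cut s" shows "r = s"
proof -
  have "\<not> a < b" if "0 \<le> a" "left_cut a = left_cut b" for a b
  proof
    assume "a < b"
    then obtain w where "a < dyadic w" "dyadic w < b" using dyadic_dense \<open>0 \<le> a\<close> by blast
    then have "w \<in> left_cut b" "w \<notin> left_cut a" unfolding left_cut_def by auto
    then show False using that(2) by blast
  qed
  then show ?thesis using assms by (metis linorder_neqE)
qed

lemma floor_double: "\<lfloor>2 ^ Suc n * r\<rfloor> div 2 = \<lfloor>2 ^ n * (r::real)\<rfloor>"
  using floor_divide_real_eq_div[of 2 "2 ^ Suc n * r"] by simp

text \<open>Both sets are equivalent to the function \<open>F\<close> giving the integer formed by
  the first \<open>n\<close> bits: the cut yields it by search, the expansion by doubling and adding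
  bits. As \<open>r\<close> is not dyadic, strict and weak comparison with dyadic rationals
  coincide.\<close>

lemma set_of_real_equiv_cut:
  assumes r: "0 \<le> r" "r \<le> 1" and nd: "\<And>w. r \<noteq> dyadic w"
  shows "Turing_equiv (set_of_real r) (left_cut r)"
proof -
  have "r \<noteq> 1" using nd[of "pair 1 0"] by simp
  define F where "F n = nat \<lfloor>2 ^ n * r\<rfloor>" for n
  have S: "n \<in> set_of_real r \<longleftrightarrow> odd (F (Suc n))" for n
    using \<open>r \<noteq> 1\<close> r by (simp add: set_of_real_def F_def even_nat_iff)
  have left_cut: "pair k n \<in> left_cut r \<longleftrightarrow> k \<le> F n" for k n
  proof -
    have "pair k n \<in> left_cut r \<longleftrightarrow> real k / 2 ^ n \<le> r"
      using nd[of "pair k n"] by (auto simp: left_cut_def)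
    also have "\<dots> \<longleftrightarrow> real k \<le> 2 ^ n * r" by (simp add: field_simps)
    also have "\<dots> \<longleftrightarrow> k \<le> F n" using r(1) by (simp add: F_def le_nat_iff le_floor_iff)
    finally show ?thesis .
  qed
  have F_Least: "F n = (LEAST k. pair (Suc k) n \<notin> left_cut r)" for n
    unfolding left_cut by (rule sym, rule Least_equality) auto
  have ex: "\<exists>k. pair (Suc k) n \<notin> left_cut r" for n
    unfolding left_cut by (rule exI[of _ "F n"]) simp
  have rF: "recursive_in (left_cut r) F"
    unfolding F_Least[abs_def] by (intro recI recursive_oracle) (rule ex)
  have 1: "Turing_le (set_of_real r) (left_cut r)"
    unfolding Turing_le_def S by (intro recI recursive_comp[OF rF])
  have F_0: "F 0 = 0" using r \<open>r \<noteq> 1\<close> by (simp add: F_def)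
  have F_Suc: "F (Suc n) = 2 * F n + of_bool (n \<in> set_of_real r)" for n
  proof -
    have "F (Suc n) div 2 = F n"
      using floor_double[of n r] r(1) by (simp add: F_def nat_div_distrib[symmetric])
    then show ?thesis unfolding S by (cases "odd (F (Suc n))") (simp_all, presburger+)
  qed
  have "F n = rec_nat 0 (\<lambda>m v. 2 * v + of_bool (m \<in> set_of_real r)) n" for n
    by (induction n) (simp_all add: F_0 F_Suc)
  then have "F = rec_nat 0 (\<lambda>m v. 2 * v + of_bool (m \<in> set_of_real r))" by (rule ext)
  moreover have "recursive_in (set_of_real r) (\<lambda>n. rec_nat 0 (\<lambda>m v. 2 * v + of_bool (m \<in> set_of_real r)) n)"
    by (intro recI recursive_oracle)
  ultimately have rF': "recursive_in (set_of_real r) F" by simp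
  have "decidable_in (set_of_real r) (\<lambda>w. pfst w \<le> F (psnd w))"
    by (intro recI recursive_comp[OF rF'])
  then have 2: "Turing_le (left_cut r) (set_of_real r)"
    unfolding Turing_le_def left_cut[symmetric] by simp
  show ?thesis using 1 2 by (simp add: Turing_equiv_def)
qed

lemma recursive_not_high: "Turing_le A {} \<Longrightarrow> \<not> high A"
  unfolding high_def using jump_mono Turing_le_trans jump_not_le by blast

text \<open>The expansion is finite, or all of \<omega> for the value 1, hence recursive. So high
  reals fall under \<open>set_of_real_equiv_cut\<close>.\<close>

lemma dyadic_not_high: "\<not> high (set_of_real (dyadic w))"
proof (rule recursive_not_high)
  show "Turing_le (set_of_real (dyadic w)) {}"
  proof (cases "dyadic w = 1")
    case True
    then show ?thesis unfolding Turing_le_def set_of_real_def by (simp add: recursive_const)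
  next
    case False
    have "n < psnd w" if "n \<in> set_of_real (dyadic w)" for n
    proof (rule ccontr)
      assume "\<not> n < psnd w"
      then obtain d where "n = psnd w + d" by (metis le_Suc_ex not_less)
      then have "2 ^ Suc n * dyadic w = of_int (2 * (2 ^ d * int (pfst w)))"
        by (simp add: dyadic_def power_add)
      then have "even \<lfloor>2 ^ Suc n * dyadic w\<rfloor>" by (simp only: floor_of_int dvd_triv_left)
      then show False using that False by (simp add: set_of_real_def)
    qed
    then have "finite (set_of_real (dyadic w))" by (meson bounded_nat_set_is_finite)
    then have "set_of_real (dyadic w) = set_decode (set_encode (set_of_real (dyadic w)))" by simp
    moreover have "decidable_in {} (\<lambda>x. x \<in> set_decode (set_encode (set_of_real (dyadic w))))"
      by (intro recI)
    ultimately show ?thesis unfolding Turing_le_def by simp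
  qed
qed

lemma high_set_of_real_equiv_cut:
  "r \<in> {0..1} \<Longrightarrow> high (set_of_real r) \<Longrightarrow> Turing_equiv (set_of_real r) (left_cut r)"
  using set_of_real_equiv_cut dyadic_not_high by (metis atLeastAtMost_iff)

section \<open>Left cuts of the members of a left-r.e. numbering\<close>

lemma len_eq_Least: "len x = (LEAST l. x + 1 \<le> 2 ^ l)"
proof (rule sym, rule Least_equality)
  have iff: "len x \<le> l \<longleftrightarrow> x + 1 \<le> 2 ^ l" for l
  proof -
    have "len x \<le> l \<longleftrightarrow> log 2 (real x + 1) \<le> real l"
      by (simp add: len_def ceiling_le_iff nat_le_iff)
    also have "\<dots> \<longleftrightarrow> real x + 1 \<le> 2 powr real l" by (simp add: log_le_iff)
    also have "\<dots> \<longleftrightarrow> real (x + 1) \<le> real (2 ^ l)" by (simp add: powr_realpow add.commute)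
    also have "\<dots> \<longleftrightarrow> x + 1 \<le> 2 ^ l" by (simp only: of_nat_le_iff)
    finally show ?thesis .
  qed
  show "x + 1 \<le> 2 ^ len x" using iff[of "len x"] by simp
  show "len x \<le> l" if "x + 1 \<le> 2 ^ l" for l using iff that by simp
qed

lemma Suc_le_power_2: "x + 1 \<le> 2 ^ (x::nat)"
  by (simp add: Suc_le_eq)

lemma len_le: "len x \<le> x"
  unfolding len_eq_Least by (rule Least_le) (rule Suc_le_power_2)

lemma recursive_len [recI]: "recursive_in A f \<Longrightarrow> recursive_in A (\<lambda>x. len (f x))"
proof (rule recursive_comp[of A len])
  show "recursive_in A len"
    unfolding len_eq_Least[abs_def] by (intro recI) (blast intro: Suc_le_power_2)
qed

lemma less_has_sum_iff:
  fixes f :: "nat \<Rightarrow> real"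
  assumes "(f has_sum a) (\<Union>s. D s)" "\<And>x. 0 \<le> f x" "\<And>s. finite (D s)" "incseq D"
  shows "q < a \<longleftrightarrow> (\<exists>s. q < sum f (D s))"
proof
  assume "q < a"
  have "(sum f \<longlongrightarrow> a) (finite_subsets_at_top (\<Union>s. D s))" using assms(1) has_sum_def by blast
  then have "\<forall>\<^sub>F X in finite_subsets_at_top (\<Union>s. D s). q < sum f X"
    using \<open>q < a\<close> order_tendstoD(1) by blast
  then obtain X where H: "finite X \<and> X \<subseteq> (\<Union>s. D s) \<and>
      (\<forall>Y. finite Y \<and> X \<subseteq> Y \<and> Y \<subseteq> (\<Union>s. D s) \<longrightarrow> q < sum f Y)"
    unfolding eventually_finite_subsets_at_top ..
  then have X: "finite X" "X \<subseteq> (\<Union>s. D s)" by blast+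
  have less: "q < sum f (D s)" if "X \<subseteq> D s" for s
    using H[THEN conjunct2, THEN conjunct2, THEN spec, of "D s"] assms(3)[of s] that by blast
  have "\<exists>s. X \<subseteq> D s" using X
  proof (induction X rule: finite_induct)
    case (insert x X)
    then obtain s s' where "X \<subseteq> D s" "x \<in> D s'" by blast
    then have "insert x X \<subseteq> D (max s s')"
      using incseqD[OF assms(4), of s "max s s'"] incseqD[OF assms(4), of s' "max s s'"] by auto
    then show ?case by blast
  qed simp
  then show "\<exists>s. q < sum f (D s)" using less by blast
next
  assume "\<exists>s. q < sum f (D s)"
  then obtain s where "q < sum f (D s)" by blast
  moreover have "sum f (D s) \<le> a"
    by (rule finite_sum_le_has_sum[OF assms(1)]) (use assms(2,3) in auto)
  ultimately show "q < a" by simp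
qed

text \<open>The weights of the arguments found to be in the domain by stage \<open>s\<close> add up
  to a dyadic rational computable from \<open>e\<close> and \<open>s\<close>; a dyadic number is in
  the cut iff one of these partial sums exceeds it.\<close>

lemma left_re_numbering_re_family:
  assumes "left_re_numbering \<alpha>" shows "re_family (\<lambda>e. left_cut (\<alpha> e))"
proof -
  obtain p where p: "\<And>e. ((\<lambda>x. (1 / 2) ^ len x) has_sum \<alpha> e) (dom (\<lambda>x. run {} p (pair e x)))"
    using assms unfolding left_re_numbering_def partial_recursive_in_def by blast
  define P where "P e x s \<longleftrightarrow> (\<exists>c<s. halts (set_decode 0) (goedel p) (pair e x) c)" for e x s
  define D where "D e s = {x. x < s \<and> P e x s}" for e s
  define N :: "nat \<Rightarrow> nat \<Rightarrow> nat" where "N e s = (\<Sum>x<s. if P e x s then 2 ^ (s - len x) else 0)" for e s :: nat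
  have UN: "(\<Union>s. D e s) = dom (\<lambda>x. run {} p (pair e x))" for e
  proof (intro equalityI subsetI)
    fix x assume "x \<in> dom (\<lambda>x. run {} p (pair e x))"
    then obtain c where "halts {} (goedel p) (pair e x) c" using run_eq_None_iff by blast
    then have "x \<in> D e (Suc (max x c))" unfolding D_def P_def by (auto intro!: exI[of _ c])
    then show "x \<in> (\<Union>s. D e s)" by blast
  next
    fix x assume "x \<in> (\<Union>s. D e s)"
    then obtain c where "halts {} (goedel p) (pair e x) c" unfolding D_def P_def by auto
    then show "x \<in> dom (\<lambda>x. run {} p (pair e x))" using run_eq_None_iff by blast
  qed
  have sum: "(\<Sum>x\<in>D e s. (1 / 2) ^ len x) = real (N e s) / 2 ^ s" for e s
  proof -
    have "D e s = {x \<in> {..<s}. P e x s}" by (auto simp: D_def)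
    then have "(\<Sum>x\<in>D e s. (1 / 2) ^ len x) = (\<Sum>x<s. if P e x s then (1 / 2) ^ len x else (0::real))"
      by (simp only: sum.inter_filter[OF finite_lessThan])
    also have "\<dots> = (\<Sum>x<s. real (if P e x s then 2 ^ (s - len x) else 0) / 2 ^ s)"
    proof (rule sum.cong)
      fix x assume "x \<in> {..<s}"
      \<comment> \<open>Hence \<open>2 ^ s\<close> is a common denominator of all weights in the
        partial sum, and \<open>s - len x\<close> is a genuine difference.\<close>
      then have "len x \<le> s" using len_le[of x] by simp
      then have "(2::real) ^ s = 2 ^ len x * 2 ^ (s - len x)" by (simp flip: power_add)
      then show "(if P e x s then (1 / 2) ^ len x else 0) = real (if P e x s then 2 ^ (s - len x) else 0) / 2 ^ s"
        by (simp add: power_one_over)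
    qed simp
    finally show ?thesis by (simp only: N_def of_nat_sum sum_divide_distrib)
  qed
  have "w \<in> left_cut (\<alpha> e) \<longleftrightarrow> (\<exists>s. dyadic w < dyadic (pair (N e s) s))" for e w
  proof -
    have "incseq (D e)" unfolding D_def P_def by (intro incseq_SucI) (auto intro: less_SucI)
    moreover have "((\<lambda>x. (1 / 2) ^ len x) has_sum \<alpha> e) (\<Union>s. D e s)" unfolding UN by (rule p)
    moreover have "finite (D e s)" for s by (simp add: D_def)
    ultimately show ?thesis
      unfolding left_cut_def mem_Collect_eq dyadic_pair sum[symmetric]
      by (intro less_has_sum_iff) simp_all
  qed
  then have iff: "w \<in> left_cut (\<alpha> e) \<longleftrightarrow> (\<exists>s. pfst w * 2 ^ s < N e s * 2 ^ psnd w)" for e w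
    unfolding dyadic_less_iff by simp
  have N: "N e s = rec_nat 0 (\<lambda>x r. if P e x s then r + 2 ^ (s - len x) else r) s" for e s
  proof -
    have "rec_nat (0::nat) (\<lambda>x r. if P e x s then r + 2 ^ (s - len x) else r) t =
        (\<Sum>x<t. if P e x s then 2 ^ (s - len x) else 0)" for t
      by (induction t) auto
    then show ?thesis by (simp add: N_def)
  qed
  show ?thesis
  proof (rule re_familyI)
    show "decidable_in {} (\<lambda>v. pfst (psnd (pfst v)) * 2 ^ psnd v < N (pfst (pfst v)) (psnd v) * 2 ^ psnd (psnd (pfst v)))"
      unfolding N P_def by (intro recI)
  qed (simp add: iff)
qed

section \<open>An enumeration of all left-r.e. reals\<close>

definition cut_member :: "nat \<Rightarrow> nat \<Rightarrow> bool" where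
  "cut_member i w \<longleftrightarrow> (\<exists>c. halts {} i w c) \<and> dyadic w \<le> 1"

text \<open>Every index gives a left-r.e. real and every left-r.e. real has an index, with uniformly
  r.e. cuts. Inserting 0 takes care of an empty set of dyadic rationals.\<close>

definition left_re_real :: "nat \<Rightarrow> real" where
  "left_re_real i = Sup (insert 0 {dyadic w | w. cut_member i w})"

lemma dyadic_le_1_iff: "dyadic w \<le> 1 \<longleftrightarrow> pfst w \<le> 2 ^ psnd w"
  unfolding dyadic_def by (simp add: divide_le_eq)

lemma bdd_above_cut_member: "bdd_above (insert 0 {dyadic w | w. cut_member i w})"
  unfolding bdd_above_def cut_member_def by (auto intro!: exI[of _ 1])

lemma left_re_real_bounds: "left_re_real i \<in> {0..1}"
  unfolding left_re_real_def atLeastAtMost_iff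
  by (intro conjI cSup_upper bdd_above_cut_member cSup_least) (auto simp: cut_member_def)

lemma less_left_re_real_iff:
  "0 \<le> q \<Longrightarrow> q < left_re_real i \<longleftrightarrow> (\<exists>w. cut_member i w \<and> q < dyadic w)"
  unfolding left_re_real_def using less_cSup_iff[OF _ bdd_above_cut_member] by auto

lemma re_family_left_re_real: "re_family (\<lambda>i. left_cut (left_re_real i))"
proof (rule re_familyI)
  show "decidable_in {} (\<lambda>v. halts (set_decode 0) (pfst (pfst v)) (pfst (psnd v)) (psnd (psnd v)) \<and>
      pfst (pfst (psnd v)) \<le> 2 ^ psnd (pfst (psnd v)) \<and>
      pfst (psnd (pfst v)) * 2 ^ psnd (pfst (psnd v)) < pfst (pfst (psnd v)) * 2 ^ psnd (psnd (pfst v)))"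
    by (intro recI)
  show "x \<in> left_cut (left_re_real i) \<longleftrightarrow> (\<exists>s. halts (set_decode 0) (pfst (pfst (pair (pair i x) s)))
      (pfst (psnd (pair (pair i x) s))) (psnd (psnd (pair (pair i x) s))) \<and>
      pfst (pfst (psnd (pair (pair i x) s))) \<le> 2 ^ psnd (pfst (psnd (pair (pair i x) s))) \<and>
      pfst (psnd (pfst (pair (pair i x) s))) * 2 ^ psnd (pfst (psnd (pair (pair i x) s)))
        < pfst (pfst (psnd (pair (pair i x) s))) * 2 ^ psnd (psnd (pfst (pair (pair i x) s))))" for i x
  proof -
    have "x \<in> left_cut (left_re_real i) \<longleftrightarrow> (\<exists>w c. halts {} i w c \<and> dyadic w \<le> 1 \<and> dyadic x < dyadic w)"
      unfolding left_cut_def using less_left_re_real_iff[OF dyadic_nonneg] by (auto simp: cut_member_def)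
    also have "\<dots> \<longleftrightarrow> (\<exists>s. halts {} i (pfst s) (psnd s) \<and> dyadic (pfst s) \<le> 1 \<and> dyadic x < dyadic (pfst s))"
      by (metis fst_conv prod_encode_inverse snd_conv)
    finally show ?thesis by (simp add: dyadic_le_1_iff dyadic_less_iff)
  qed
qed

lemma left_re_real_in: "left_re_real i \<in> left_re_reals"
proof -
  define ok where "ok s v \<longleftrightarrow> halts (set_decode 0) i (pfst s) (psnd s) \<and> pfst (pfst s) \<le> 2 ^ psnd (pfst s) \<and>
    pfst v * 2 ^ psnd (pfst s) < pfst (pfst s) * 2 ^ psnd v" for s v
  \<comment> \<open>Running maximum of the dyadic rationals found so far, starting from 0; the
    number \<open>s\<close> codes a dyadic rational together with a computation enumerating
    it.\<close>
  define st where "st = rec_nat (pair 0 0) (\<lambda>s v. if ok s v then pfst s else v)"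
  have st_Suc: "st (Suc s) = (if ok s (st s) then pfst s else st s)" for s by (simp add: st_def)
  have ok: "ok s v \<longleftrightarrow> halts {} i (pfst s) (psnd s) \<and> dyadic (pfst s) \<le> 1 \<and> dyadic v < dyadic (pfst s)" for s v
    by (simp add: ok_def dyadic_le_1_iff dyadic_less_iff)
  \<comment> \<open>The term \<open>Suc (2 ^ k - 1)\<close> is \<open>2 ^ k\<close> in the form of a
    denominator required by \<open>recursive_rat_seq\<close>.\<close>
  define q :: "nat \<Rightarrow> rat" where "q n = (of_nat (pfst (st n)) - of_nat 0) / of_nat (Suc (2 ^ psnd (st n) - 1))" for n
  have rq: "real_of_rat (q n) = dyadic (st n)" for n
    by (simp add: q_def dyadic_def of_rat_divide of_rat_power)
  have st: "recursive st" unfolding st_def ok_def by (intro recI)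
  have "recursive (\<lambda>n. pfst (st n))" "recursive (\<lambda>n. 2 ^ psnd (st n) - 1)" "recursive (\<lambda>n. 0)"
    by (intro recI st)+
  then have "recursive_rat_seq q"
    unfolding recursive_rat_seq_def q_def by blast
  moreover have inc: "incseq (\<lambda>n. dyadic (st n))"
    by (rule incseq_SucI) (simp add: st_Suc ok less_imp_le)
  then have "incseq q"
    unfolding incseq_def rq[symmetric] by (simp add: of_rat_less_eq)
  moreover have "(\<lambda>n. real_of_rat (q n)) \<longlonglongrightarrow> left_re_real i"
  proof -
    have le: "dyadic (st n) \<le> left_re_real i" for n
    proof (induction n)
      case 0
      then show ?case using left_re_real_bounds by (simp add: st_def)
    next
      case (Suc n)
      have "dyadic (pfst n) \<le> left_re_real i" if "ok n (st n)"
        unfolding left_re_real_def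
        by (rule cSup_upper[OF _ bdd_above_cut_member]) (use that in \<open>auto simp: ok cut_member_def\<close>)
      then show ?case using Suc by (simp add: st_Suc)
    qed
    show ?thesis unfolding rq
    proof (rule increasing_tendsto)
      show "\<forall>\<^sub>F n in sequentially. dyadic (st n) \<le> left_re_real i" using le by simp
      fix y assume y: "y < left_re_real i"
      show "\<forall>\<^sub>F n in sequentially. y < dyadic (st n)"
      proof (cases "y < 0")
        case True
        then show ?thesis using dyadic_nonneg less_le_trans by (intro always_eventually) blast
      next
        case False
        then obtain w c where w: "halts {} i w c" "dyadic w \<le> 1" "y < dyadic w"
          using y less_left_re_real_iff[of y i] by (auto simp: cut_member_def)
        have "dyadic w \<le> dyadic (st (Suc (pair w c)))" using w by (auto simp: st_Suc ok)
        then have "y < dyadic (st n)" if "Suc (pair w c) \<le> n" for n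
          using w(3) incseqD[OF inc that] by linarith
        then show ?thesis unfolding eventually_sequentially by blast
      qed
    qed
  qed
  ultimately show ?thesis unfolding left_re_reals_def using left_re_real_bounds by blast
qed

text \<open>The rational approximations enumerate the left cut of \<open>r\<close>, and by density
  of the dyadic rationals the supremum of this cut is \<open>r\<close>; an index of the cut is the
  desired \<open>i\<close>.\<close>

lemma left_re_real_surj:
  assumes "r \<in> left_re_reals" shows "\<exists>i. r = left_re_real i"
proof -
  obtain q where q: "recursive_rat_seq q" "incseq q" "(\<lambda>n. real_of_rat (q n)) \<longlonglongrightarrow> r" and r: "0 \<le> r" "r \<le> 1"
    using assms unfolding left_re_reals_def by auto
  obtain a b c where abc: "recursive a" "recursive b" "recursive c"
    "\<And>n. q n = (of_nat (a n) - of_nat (b n)) / of_nat (Suc (c n))"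
    using q(1) unfolding recursive_rat_seq_def by blast
  have rq: "real_of_rat (q n) = (real (a n) - real (b n)) / real (Suc (c n))" for n
    unfolding abc(4) by (simp add: of_rat_divide of_rat_diff del: of_nat_Suc)
  have "incseq (\<lambda>n. real_of_rat (q n))" using q(2) by (simp add: incseq_def of_rat_less_eq)
  then have le: "real_of_rat (q n) \<le> r" for n using q(3) incseq_le by blast
  have "w \<in> left_cut r \<longleftrightarrow> (\<exists>n. dyadic w < real_of_rat (q n))" for w
  proof
    assume "w \<in> left_cut r"
    then have "\<forall>\<^sub>F n in sequentially. dyadic w < real_of_rat (q n)"
      using q(3) order_tendstoD(1) unfolding left_cut_def by blast
    then show "\<exists>n. dyadic w < real_of_rat (q n)" using eventually_happens by fastforce
  next
    assume "\<exists>n. dyadic w < real_of_rat (q n)"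
    then show "w \<in> left_cut r" using le less_le_trans unfolding left_cut_def by blast
  qed
  \<comment> \<open>The numerator may be negative, so \<open>b n\<close> is moved to the other side
    before passing to natural numbers.\<close>
  moreover have "dyadic w < real_of_rat (q n) \<longleftrightarrow> pfst w * Suc (c n) + b n * 2 ^ psnd w < a n * 2 ^ psnd w" for w n
  proof -
    have "dyadic w < real_of_rat (q n) \<longleftrightarrow>
        real (pfst w) * real (Suc (c n)) < (real (a n) - real (b n)) * 2 ^ psnd w"
      unfolding rq dyadic_def by (simp add: divide_less_eq less_divide_eq field_simps del: of_nat_Suc)
    also have "\<dots> \<longleftrightarrow> real (pfst w * Suc (c n) + b n * 2 ^ psnd w) < real (a n * 2 ^ psnd w)"
      by (simp add: left_diff_distrib less_diff_eq del: of_nat_Suc mult_Suc_right)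
    finally show ?thesis by (simp only: of_nat_less_iff)
  qed
  ultimately have "w \<in> left_cut r \<longleftrightarrow> (\<exists>n. pfst w * Suc (c n) + b n * 2 ^ psnd w < a n * 2 ^ psnd w)" for w by simp
  moreover have "decidable_in {} (\<lambda>v. pfst (pfst v) * Suc (c (psnd v)) + b (psnd v) * 2 ^ psnd (pfst v)
      < a (psnd v) * 2 ^ psnd (pfst v))"
    by (intro recI recursive_comp[OF abc(1)] recursive_comp[OF abc(2)] recursive_comp[OF abc(3)])
  ultimately have "re_in {} (left_cut r)" by (intro re_inI) auto
  then obtain p where p: "\<And>w. run {} p w \<noteq> None \<longleftrightarrow> w \<in> left_cut r" by (rule re_in_dom) blast
  have mem: "cut_member (goedel p) w \<longleftrightarrow> dyadic w < r" for w
    using p[of w] r(2) unfolding cut_member_def run_eq_None_iff[symmetric] by (auto simp: left_cut_def)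
  have "dyadic x < r \<longleftrightarrow> (\<exists>w. dyadic w < r \<and> dyadic x < dyadic w)" for x
    using dyadic_dense[OF dyadic_nonneg, of x r] by (meson less_trans)
  then have "left_cut r = left_cut (left_re_real (goedel p))"
    unfolding left_cut_def less_left_re_real_iff[OF dyadic_nonneg] mem by (rule Collect_cong)
  then have "r = left_re_real (goedel p)"
    using left_cut_inject r(1) left_re_real_bounds by (meson atLeastAtMost_iff)
  then show ?thesis ..
qed

section \<open>Index sets of classes of left-r.e. reals\<close>

lemma Sigma_set_not_in_family:
  assumes "re_family L" "re_family M" shows "Sigma_set 4 {i. \<forall>j. L i \<noteq> M j}"
proof -
  obtain R where R: "decidable_in {} R" "\<And>i x. x \<in> L i \<longleftrightarrow> (\<exists>s. R (pair (pair i x) s))"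
    using re_familyE[OF assms(1)] by blast
  obtain T where T: "decidable_in {} T" "\<And>i x. x \<in> M i \<longleftrightarrow> (\<exists>s. T (pair (pair i x) s))"
    using re_familyE[OF assms(2)] by blast
  \<comment> \<open>Two r.e. sets differ iff some \<open>x\<close> appears in one of them at a stage
    \<open>s\<close> and in the other at no stage \<open>t\<close>.\<close>
  define Z where "Z i j x s t \<longleftrightarrow> R (pair (pair i x) s) \<and> \<not> T (pair (pair j x) t) \<or>
      T (pair (pair j x) s) \<and> \<not> R (pair (pair i x) t)" for i j x s t
  have "L i \<noteq> M j \<longleftrightarrow> (\<exists>v. \<forall>t. Z i j (pfst v) (psnd v) t)" for i j
  proof
    assume "L i \<noteq> M j"
    then obtain x where "x \<in> L i \<and> x \<notin> M j \<or> x \<in> M j \<and> x \<notin> L i" by blast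
    then obtain s where "\<forall>t. Z i j x s t" unfolding R(2) T(2) Z_def by blast
    then show "\<exists>v. \<forall>t. Z i j (pfst v) (psnd v) t" by (intro exI[of _ "pair x s"]) simp
  next
    assume "\<exists>v. \<forall>t. Z i j (pfst v) (psnd v) t"
    then obtain x s where "\<And>t. Z i j x s t" by blast
    then have "x \<in> L i \<and> x \<notin> M j \<or> x \<in> M j \<and> x \<notin> L i" unfolding R(2) T(2) Z_def by metis
    then show "L i \<noteq> M j" by blast
  qed
  \<comment> \<open>The vacuous \<open>p\<close> pads the three alternating quantifiers to the
    prefix of \<open>Sigma_set_4I\<close>.\<close>
  then have eq: "{i. \<forall>j. L i \<noteq> M j} = {i. \<exists>p::nat. \<forall>j. \<exists>v. \<forall>t. Z i j (pfst v) (psnd v) t}" by simp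
  define Y where "Y x \<longleftrightarrow> Z (pfst (pfst (pfst (pfst x)))) (psnd (pfst (pfst x))) (pfst (psnd (pfst x)))
      (psnd (psnd (pfst x))) (psnd x)" for x
  have "decidable_in {} Y" unfolding Y_def Z_def
    by (intro recI recursive_comp[OF R(1)] recursive_comp[OF T(1)])
  from Sigma_set_4I[OF this] show ?thesis unfolding eq by (simp add: Y_def)
qed

text \<open>Members of \<open>C\<close> are high, hence equivalent to their left cuts, and these
  form an r.e. family to which \<open>high_family_not_Sigma_4\<close> applies. The form with an
  arbitrary \<open>\<gamma>\<close> covers left-r.e. numberings as well as
  \<open>left_re_real\<close>.\<close>

lemma cut_family_not_Sigma_4:
  assumes "C \<subseteq> left_re_reals" "\<And>r. r \<in> C \<Longrightarrow> high (set_of_real r)"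
    and "\<And>W. re_set W \<Longrightarrow> high W \<Longrightarrow> \<exists>r\<in>C. Turing_equiv W (set_of_real r)"
    and "re_family (\<lambda>i. left_cut (\<gamma> i))" "C \<subseteq> range \<gamma>"
  shows "\<not> Sigma_set 4 {i. \<gamma> i \<in> C}"
proof
  have equiv: "Turing_equiv (set_of_real r) (left_cut r)" if "r \<in> C" for r
    using that assms(1,2) by (intro high_set_of_real_equiv_cut) (auto simp: left_re_reals_def)
  assume "Sigma_set 4 {i. \<gamma> i \<in> C}"
  then show False
  proof (rule high_family_not_Sigma_4[OF assms(4)])
    show "high (left_cut (\<gamma> i))" if "i \<in> {i. \<gamma> i \<in> C}" for i
      using that assms(2) equiv Turing_equiv_high unfolding Turing_equiv_def by blast
    show "\<exists>i\<in>{i. \<gamma> i \<in> C}. Turing_equiv W (left_cut (\<gamma> i))" if W: "re_set W" "high W" for W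
    proof -
      obtain r where r: "r \<in> C" "Turing_equiv W (set_of_real r)" using assms(3)[OF W] by blast
      then have "Turing_equiv W (left_cut r)"
        using equiv Turing_le_trans unfolding Turing_equiv_def by blast
      then show ?thesis using r(1) assms(5) by blast
    qed
  qed
qed

theorem theorem5p4:
  fixes C :: "real set"
  assumes "C \<subseteq> left_re_reals"
    and "\<And>r. r \<in> C \<Longrightarrow> high (set_of_real r)"
    and "\<And>W. re_set W \<Longrightarrow> high W \<Longrightarrow> \<exists>r\<in>C. Turing_equiv W (set_of_real r)"
  shows "(\<forall>\<alpha>. universal_left_re_numbering \<alpha> \<longrightarrow> \<not> Sigma_set 4 {e. \<alpha> e \<in> C})
       \<and> (\<nexists>\<beta>. left_re_numbering_of \<beta> C)
       \<and> (\<nexists>\<beta>. left_re_numbering_of \<beta> (left_re_reals - C))"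
proof (intro conjI allI impI notI)
  fix \<alpha> assume "universal_left_re_numbering \<alpha>" and S: "Sigma_set 4 {e. \<alpha> e \<in> C}"
  then have "left_re_numbering \<alpha>" "range \<alpha> = left_re_reals"
    unfolding universal_left_re_numbering_def left_re_numbering_of_def by auto
  then show False
    using cut_family_not_Sigma_4[OF assms left_re_numbering_re_family] S assms(1) by simp
next
  assume "\<exists>\<beta>. left_re_numbering_of \<beta> C"
  then obtain \<beta> where \<beta>: "left_re_numbering \<beta>" "range \<beta> = C" unfolding left_re_numbering_of_def by blast
  \<comment> \<open>Since \<open>\<beta>\<close> has range \<open>C\<close>, this index set is all
    of \<omega>.\<close>
  have "Sigma_set 4 {e. \<beta> e \<in> C}"
    using Sigma_set_4I[of "\<lambda>x. True"] recursive_const \<beta>(2) by auto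
  then show False using cut_family_not_Sigma_4[OF assms left_re_numbering_re_family[OF \<beta>(1)]] \<beta>(2) by simp
next
  assume "\<exists>\<beta>. left_re_numbering_of \<beta> (left_re_reals - C)"
  then obtain \<beta> where \<beta>: "left_re_numbering \<beta>" "range \<beta> = left_re_reals - C"
    unfolding left_re_numbering_of_def by blast
  \<comment> \<open>Membership in \<open>C\<close> means differing from every
    \<open>\<beta> j\<close>. Inequality of uniformly r.e. cuts makes this
    \<open>\<Sigma>\<^sub>4\<close>, so a numbering of the complement would give \<open>C\<close> a
    \<open>\<Sigma>\<^sub>4\<close> index set.\<close>
  have "left_re_real i \<in> C \<longleftrightarrow> (\<forall>j. left_cut (left_re_real i) \<noteq> left_cut (\<beta> j))" for i
  proof -
    have "0 \<le> \<beta> j" for j using \<beta>(2) by (auto simp: left_re_reals_def)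
    then have "left_cut (left_re_real i) = left_cut (\<beta> j) \<longleftrightarrow> left_re_real i = \<beta> j" for j
      using left_cut_inject left_re_real_bounds by (metis atLeastAtMost_iff)
    moreover have "left_re_real i \<in> C \<longleftrightarrow> left_re_real i \<notin> range \<beta>" unfolding \<beta>(2) using left_re_real_in by blast
    ultimately show ?thesis by auto
  qed
  then have "Sigma_set 4 {i. left_re_real i \<in> C}"
    using Sigma_set_not_in_family[OF re_family_left_re_real left_re_numbering_re_family[OF \<beta>(1)]] by simp
  moreover have "C \<subseteq> range left_re_real" using assms(1) left_re_real_surj by blast
  ultimately show False using cut_family_not_Sigma_4[OF assms re_family_left_re_real] by blast
qed

end
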